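(* Let $n\ge 1$, let $\mathfrak g=\mathfrak p(n)$ be the periplectic Lie superalgebra over $\mathbb C$ with the choice of positive odd roots $\Delta^+_{\bar 1}=\Delta(\mathfrak g_{-1})=\{-(\varepsilon_i+\varepsilon_j):1\le i<j\le n\}$ and positive even roots $\Delta^+_{\bar 0}=\{\varepsilon_i-\varepsilon_j:1\le i<j\le n\}$. Let $\rho=\sum_{i=1}^n (n-i)\varepsilon_i$ and $$R=\frac{\prod_{1\le i<j\le n}\left(1-e^{-(\varepsilon_i-\varepsilon_j)}\right)}{\prod_{1\le i<j\le n}\left(1-e^{\varepsilon_i+\varepsilon_j}\right)}.$$ Let $r=\lfloor n/2\rfloor$ and $\beta_1=-(\varepsilon_1+\varepsilon_2),\ \beta_2=-(\varepsilon_3+\varepsilon_4),\ \ldots,\ \beta_r=-(\varepsilon_{2r-1}+\varepsilon_{2r})$. Then $$e^{\rho}R=\sum_{w\in W}(\operatorname{sgn} w)\, w\left(\frac{e^{\rho}}{(1-e^{-\beta_1})(1-e^{-\beta_1-\beta_2})\cdots(1-e^{-\beta_1-\cdots-\beta_r})}\right).$$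
   Context: The periplectic Lie superalgebra $\mathfrak p(n)$ is the Lie superalgebra of all endomorphisms $X$ of an $(n|n)$-dimensional complex superspace $V$ preserving a non-degenerate odd symmetric bilinear form $\beta$ on $V$ (that is, $\beta(Xv,w)+(-1)^{\bar X\bar v}\beta(v,Xw)=0$); in a suitable basis its elements are the matrices $\begin{pmatrix}A&B\\ C&-A^t\end{pmatrix}$ with $A,B,C$ complex $n\times n$ matrices, $B^t=B$, $C^t=-C$. The Cartan subalgebra $\mathfrak h$ is the set of diagonal matrices in it, and $\varepsilon_1,\ldots,\varepsilon_n$ is the standard basis of $\mathfrak h^*$. The root set is $\Delta=\Delta(\mathfrak g_{-1})\cup\Delta(\mathfrak g_0)\cup\Delta(\mathfrak g_1)$, with even roots $\Delta(\mathfrak g_0)=\{\varepsilon_i-\varepsilon_j: i\neq j\}$ and odd roots $\Delta(\mathfrak g_1)=\{\varepsilon_i+\varepsilon_j:1\le i\le j\le n\}$, $\Delta(\mathfrak g_{-1})=\{-(\varepsilon_i+\varepsilon_j):1\le i<j\le n\}$. For a choice of positive roots, $\rho=\rho_{\bar 0}-\rho_{\bar 1}$, where $\rho_{\bar 0}$ and $\rho_{\bar 1}$ are the half-sums of the positive even and positive odd roots; here this equals $\sum_{i=1}^n(n-i)\varepsilon_i$. The denominator is $R=\prod_{\alpha\in\Delta^+_{\bar 0}}(1-e^{-\alpha})\big/\prod_{\alpha\in\Delta^+_{\bar 1}}(1-e^{-\alpha})$. The identity is in the rational function field generated by the formal exponentials $e^\lambda$, $\lambda\in\mathfrak h^*$,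 with $e^\lambda e^\mu=e^{\lambda+\mu}$, $e^0=1$. The Weyl group is $W=S_n$, acting on $\mathfrak h^*$ by $w(\varepsilon_i)=\varepsilon_{w(i)}$ and by field automorphisms $w(e^\lambda)=e^{w\lambda}$; $\operatorname{sgn} w$ is the sign of the permutation $w$. Empty products are $1$. The $k$-th factor of the displayed denominator is $1-e^{-(\beta_1+\cdots+\beta_k)}$, $1\le k\le r$. *)

theory Defs
  imports
    "Jordan_Normal_Form.Matrix"
    "HOL-Library.Poly_Mapping"
    "HOL-Computational_Algebra.Fraction_Field"
    "HOL-Combinatorics.Permutations"
begin

section \<open>Weights\<close>

text \<open>
  The dual Cartan subalgebra of \<open>p(n)\<close> is the space of those weights whose coordinates vanish
  outside \<open>{1..n}\<close> (\<open>hdual n\<close> below); the type \<open>weight\<close> is the union of these spaces over all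
  \<open>n\<close>. It is a type of its own, rather than \<open>nat \<Rightarrow>\<^sub>0 complex\<close>, because it needs a linear order.
\<close>

typedef weight = "UNIV :: (nat \<Rightarrow>\<^sub>0 complex) set"
  morphisms coords Weight ..

setup_lifting type_definition_weight

lift_definition coord :: "weight \<Rightarrow> nat \<Rightarrow> complex" is Poly_Mapping.lookup .

lift_definition eps :: "nat \<Rightarrow> weight" is "\<lambda>i. Poly_Mapping.single i 1" .

lift_definition scale :: "complex \<Rightarrow> weight \<Rightarrow> weight" is "\<lambda>c. Poly_Mapping.map ((*) c)" .

lemma weight_eqI: "(\<And>i. coord u i = coord v i) \<Longrightarrow> u = v"
  by transfer (rule poly_mapping_eqI)

lemma finite_coord: "finite {i. coord u i \<noteq> 0}"
  by transfer simp

lemma coord_eps: "coord (eps i) j = (if i = j then 1 else 0)"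
  by transfer (simp add: lookup_single when_def)

lemma coord_scale [simp]: "coord (scale c u) i = c * coord u i"
  by transfer (simp add: map.rep_eq when_def)

instantiation weight :: ab_group_add
begin

lift_definition zero_weight :: weight is 0 .
lift_definition plus_weight :: "weight \<Rightarrow> weight \<Rightarrow> weight" is "(+)" .
lift_definition minus_weight :: "weight \<Rightarrow> weight \<Rightarrow> weight" is "(-)" .
lift_definition uminus_weight :: "weight \<Rightarrow> weight" is uminus .

instance
  by standard (transfer; simp add: ac_simps)+

end

lemma coord_simps [simp]:
  "coord 0 i = 0"
  "coord (u + v) i = coord u i + coord v i"
  "coord (u - v) i = coord u i - coord v i"
  "coord (- u) i = - coord u i"
  by (transfer; simp add: lookup_add lookup_minus)+

text \<open>
  An arbitrary translation-invariant linear order on weights. Its only purpose is to supply the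
  sort constraint under which the library proves that the group algebra below has no zero
  divisors; neither the multiplication nor any later definition depends on it.
\<close>

lift_definition re_part :: "weight \<Rightarrow> nat \<Rightarrow>\<^sub>0 real" is "\<lambda>l. Poly_Mapping.map Re l" .
lift_definition im_part :: "weight \<Rightarrow> nat \<Rightarrow>\<^sub>0 real" is "\<lambda>l. Poly_Mapping.map Im l" .

lemma lookup_re_part [simp]: "Poly_Mapping.lookup (re_part l) i = Re (coord l i)"
  by transfer (simp add: map.rep_eq when_def)

lemma lookup_im_part [simp]: "Poly_Mapping.lookup (im_part l) i = Im (coord l i)"
  by transfer (simp add: map.rep_eq when_def)

lemma re_part_add: "re_part (u + v) = re_part u + re_part v"
  by (rule poly_mapping_eqI) (simp add: lookup_add)

lemma im_part_add: "im_part (u + v) = im_part u + im_part v"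
  by (rule poly_mapping_eqI) (simp add: lookup_add)

lemma weight_parts_eqI: "re_part u = re_part v \<Longrightarrow> im_part u = im_part v \<Longrightarrow> u = v"
  by (intro weight_eqI complex_eqI) (metis lookup_re_part, metis lookup_im_part)

instantiation weight :: linorder
begin

definition less_eq_weight :: "weight \<Rightarrow> weight \<Rightarrow> bool" where
  "u \<le> v \<longleftrightarrow> re_part u < re_part v \<or> re_part u = re_part v \<and> im_part u \<le> im_part v"

definition less_weight :: "weight \<Rightarrow> weight \<Rightarrow> bool" where
  "u < v \<longleftrightarrow> re_part u < re_part v \<or> re_part u = re_part v \<and> im_part u < im_part v"

instance
  by standard (auto simp: less_eq_weight_def less_weight_def intro: weight_parts_eqI)

end

instance weight :: ordered_ab_group_add
  by standard (auto simp: less_eq_weight_def re_part_add im_part_add)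

lemma coord_sum: "coord (\<Sum>x\<in>A. f x) i = (\<Sum>x\<in>A. coord (f x) i)"
  by (induction A rule: infinite_finite_induct) auto

section \<open>The Lie superalgebra and its roots\<close>

text \<open>
  Matrix rows and columns are numbered from \<open>0\<close>, the weights \<open>eps i\<close> from \<open>1\<close>.
\<close>

definition periplectic :: "nat \<Rightarrow> complex mat set" where
  "periplectic n = {four_block_mat A B C (- A\<^sup>T) | A B C.
     A \<in> carrier_mat n n \<and> B \<in> carrier_mat n n \<and> C \<in> carrier_mat n n \<and> B\<^sup>T = B \<and> C\<^sup>T = - C}"

definition periplectic_0 :: "nat \<Rightarrow> complex mat set" where
  "periplectic_0 n = {four_block_mat A (0\<^sub>m n n) (0\<^sub>m n n) (- A\<^sup>T) | A. A \<in> carrier_mat n n}"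

definition periplectic_1 :: "nat \<Rightarrow> complex mat set" where
  "periplectic_1 n = {four_block_mat (0\<^sub>m n n) B (0\<^sub>m n n) (0\<^sub>m n n) | B.
     B \<in> carrier_mat n n \<and> B\<^sup>T = B}"

definition periplectic_m1 :: "nat \<Rightarrow> complex mat set" where
  "periplectic_m1 n = {four_block_mat (0\<^sub>m n n) (0\<^sub>m n n) C (0\<^sub>m n n) | C.
     C \<in> carrier_mat n n \<and> C\<^sup>T = - C}"

definition cartan :: "nat \<Rightarrow> complex mat set" where
  "cartan n = {H \<in> periplectic n. diagonal_mat H}"

definition hdual :: "nat \<Rightarrow> weight set" where
  "hdual n = {l. \<forall>i. coord l i \<noteq> 0 \<longrightarrow> i \<in> {1..n}}"

definition weight_eval :: "nat \<Rightarrow> weight \<Rightarrow> complex mat \<Rightarrow> complex" where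
  "weight_eval n l H = (\<Sum>i = 1..n. coord l i * H $$ (i - 1, i - 1))"

text \<open>
  The nonzero weights of the Cartan subalgebra on a subspace \<open>S\<close>. Elements of the Cartan
  subalgebra are even, so the superbracket with them is the ordinary commutator.
\<close>

definition roots_of :: "nat \<Rightarrow> complex mat set \<Rightarrow> weight set" where
  "roots_of n S = {\<alpha> \<in> hdual n. \<alpha> \<noteq> 0 \<and>
     (\<exists>X \<in> S. X \<noteq> 0\<^sub>m (n + n) (n + n) \<and>
        (\<forall>H \<in> cartan n. H * X - X * H = weight_eval n \<alpha> H \<cdot>\<^sub>m X))}"

lemma cartan_iff:
  "H \<in> cartan n \<longleftrightarrow>
     (\<exists>d. H = mat_diag (n + n) (\<lambda>p. if p < n then d p else - d (p - n)))" (is "_ = ?R")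
proof
  assume "H \<in> cartan n"
  then obtain A B C where H: "H = four_block_mat A B C (- A\<^sup>T)" and diag: "diagonal_mat H"
    and c: "A \<in> carrier_mat n n" "B \<in> carrier_mat n n" "C \<in> carrier_mat n n"
    unfolding cartan_def periplectic_def by auto
  have d: "H $$ (p, q) = 0" if "p < n + n" "q < n + n" "p \<noteq> q" for p q
    using diag that c unfolding diagonal_mat_def H by auto
  have "H = mat_diag (n + n) (\<lambda>p. if p < n then A $$ (p, p) else - A $$ (p - n, p - n))"
  proof (rule eq_matI)
    fix p q assume "p < dim_row (mat_diag (n + n) (\<lambda>p. if p < n then A $$ (p, p) else - A $$ (p - n, p - n)))"
      "q < dim_col (mat_diag (n + n) (\<lambda>p. if p < n then A $$ (p, p) else - A $$ (p - n, p - n)))"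
    then have pq: "p < n + n" "q < n + n" by (auto simp: mat_diag_def)
    show "H $$ (p, q) = mat_diag (n + n) (\<lambda>p. if p < n then A $$ (p, p) else - A $$ (p - n, p - n)) $$ (p, q)"
    proof (cases "p = q")
      case True
      then show ?thesis using pq c by (auto simp: H mat_diag_def)
    next
      case False
      then show ?thesis using pq d by (auto simp: mat_diag_def)
    qed
  qed (use c in \<open>auto simp: H mat_diag_def\<close>)
  then show ?R by (intro exI[of _ "\<lambda>p. A $$ (p, p)"])
next
  assume ?R
  then obtain d where H: "H = mat_diag (n + n) (\<lambda>p. if p < n then d p else - d (p - n))" by blast
  have "H = four_block_mat (mat_diag n d) (0\<^sub>m n n) (0\<^sub>m n n) (- (mat_diag n d)\<^sup>T)"
    unfolding H by (rule eq_matI) (auto simp: mat_diag_def)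
  moreover have "(0\<^sub>m n n)\<^sup>T = (0\<^sub>m n n :: complex mat)" "(0\<^sub>m n n)\<^sup>T = - (0\<^sub>m n n :: complex mat)"
    by (auto intro: eq_matI)
  ultimately have "H \<in> periplectic n"
    unfolding periplectic_def by (intro CollectI exI[of _ "mat_diag n d"] exI[of _ "0\<^sub>m n n"]) auto
  moreover have "diagonal_mat H"
    by (auto simp: H diagonal_mat_def mat_diag_def)
  ultimately show "H \<in> cartan n" by (simp add: cartan_def)
qed

text \<open>The weight of the \<open>p\<close>-th standard basis vector of the \<open>(n|n)\<close>-dimensional module.\<close>

definition std_weight :: "nat \<Rightarrow> nat \<Rightarrow> weight" where
  "std_weight n p = (if p < n then eps (p + 1) else - eps (p - n + 1))"

lemma weight_eval_cartan:
  assumes "H = mat_diag (n + n) (\<lambda>p. if p < n then d p else - d (p - n))"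
  shows "weight_eval n l H = (\<Sum>i = 1..n. coord l i * d (i - 1))"
  unfolding weight_eval_def assms
proof (intro sum.cong refl)
  fix i assume "i \<in> {1..n}"
  then have "i - 1 < n" by auto
  then show "coord l i * mat_diag (n + n) (\<lambda>p. if p < n then d p else - d (p - n)) $$ (i - 1, i - 1) =
    coord l i * d (i - 1)"
    by (simp add: mat_diag_def)
qed

lemma weight_eval_std_weight:
  assumes H: "H = mat_diag (n + n) (\<lambda>p. if p < n then d p else - d (p - n))"
    and "p < n + n" "q < n + n"
  shows "weight_eval n (std_weight n p - std_weight n q) H = H $$ (p, p) - H $$ (q, q)"
proof -
  have e: "(\<Sum>i = 1..n. coord (eps (k + 1)) i * d (i - 1)) = d k" if "k < n" for k
  proof -
    have "(\<Sum>i = 1..n. coord (eps (k + 1)) i * d (i - 1)) = (\<Sum>i = 1..n. if i = k + 1 then d k else 0)"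
      by (intro sum.cong refl) (simp add: coord_eps)
    also have "\<dots> = d k" using that by (subst sum.delta) auto
    finally show ?thesis .
  qed
  have *: "weight_eval n (std_weight n p) H = H $$ (p, p)" if "p < n + n" for p
  proof (cases "p < n")
    case True
    then show ?thesis
      unfolding weight_eval_cartan[OF H] std_weight_def if_P[OF True] e[OF True]
      by (simp add: H mat_diag_def)
  next
    case False
    then have "p - n < n" using that by simp
    have "(\<Sum>i = 1..n. coord (- eps (p - n + 1)) i * d (i - 1)) =
      - (\<Sum>i = 1..n. coord (eps (p - n + 1)) i * d (i - 1))"
      by (simp only: coord_simps mult_minus_left sum_negf)
    also have "\<dots> = - d (p - n)" by (simp only: e[OF \<open>p - n < n\<close>])
    finally show ?thesis
      using False that unfolding weight_eval_cartan[OF H] std_weight_def if_not_P[OF False]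
      by (simp add: H mat_diag_def)
  qed
  have "weight_eval n (std_weight n p - std_weight n q) H =
    weight_eval n (std_weight n p) H - weight_eval n (std_weight n q) H"
    unfolding weight_eval_def by (simp only: coord_simps left_diff_distrib sum_subtractf)
  then show ?thesis using assms(2,3) by (simp only: *)
qed

lemma weight_eval_eqD:
  assumes "u \<in> hdual n" "v \<in> hdual n" "\<And>H. H \<in> cartan n \<Longrightarrow> weight_eval n u H = weight_eval n v H"
  shows "u = v"
proof (rule weight_eqI)
  fix k
  show "coord u k = coord v k"
  proof (cases "k \<in> {1..n}")
    case True
    define d where "d = (\<lambda>p. if p = k - 1 then 1 else 0 :: complex)"
    define H where "H = mat_diag (n + n) (\<lambda>p. if p < n then d p else - d (p - n))"
    have "weight_eval n l H = coord l k" for l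
    proof -
      have "weight_eval n l H = (\<Sum>i = 1..n. coord l i * d (i - 1))"
        by (rule weight_eval_cartan[OF H_def])
      also have "\<dots> = (\<Sum>i = 1..n. if i = k then coord l i else 0)"
      proof (intro sum.cong refl)
        fix i assume "i \<in> {1..n}"
        then have "i - 1 = k - 1 \<longleftrightarrow> i = k" using True by auto
        then show "coord l i * d (i - 1) = (if i = k then coord l i else 0)"
          by (simp only: d_def) simp
      qed
      also have "\<dots> = coord l k" using True by (subst sum.delta) auto
      finally show ?thesis .
    qed
    moreover have "H \<in> cartan n"
      unfolding cartan_iff H_def by (intro exI[of _ d] refl)
    ultimately show ?thesis using assms(3)[of H] by simp
  next
    case False
    then have "coord l k = 0" if "l \<in> hdual n" for l
      using that unfolding hdual_def by blast
    then show ?thesis using assms(1,2) by simp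
  qed
qed

lemma std_weight_hdual:
  assumes "p < n + n"
  shows "std_weight n p \<in> hdual n"
proof -
  have "eps i \<in> hdual n" "- eps i \<in> hdual n" if "i \<in> {1..n}" for i
    using that by (simp_all add: hdual_def coord_eps)
  then show ?thesis
    using assms by (cases "p < n") (simp_all add: std_weight_def less_diff_conv2)
qed

lemma hdual_diff: "u \<in> hdual n \<Longrightarrow> v \<in> hdual n \<Longrightarrow> u - v \<in> hdual n"
proof -
  assume "u \<in> hdual n" "v \<in> hdual n"
  then have "coord u i = 0 \<and> coord v i = 0" if "i \<notin> {1..n}" for i
    using that unfolding hdual_def by blast
  then have "coord (u - v) i = 0" if "i \<notin> {1..n}" for i
    using that by simp
  then show ?thesis unfolding hdual_def by blast
qed

lemma std_weight_diff_hdual: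
  "p < n + n \<Longrightarrow> q < n + n \<Longrightarrow> std_weight n p - std_weight n q \<in> hdual n"
  by (intro hdual_diff std_weight_hdual)

lemma roots_of_eq:
  assumes S: "S \<subseteq> carrier_mat (n + n) (n + n)"
  shows "roots_of n S = {\<alpha>. \<alpha> \<noteq> 0 \<and> (\<exists>X\<in>S. X \<noteq> 0\<^sub>m (n + n) (n + n) \<and>
    (\<forall>p<n + n. \<forall>q<n + n. X $$ (p, q) \<noteq> 0 \<longrightarrow> \<alpha> = std_weight n p - std_weight n q))}"
proof -
  have comm: "(H * X - X * H) $$ (p, q) = weight_eval n (std_weight n p - std_weight n q) H * X $$ (p, q)"
    if "X \<in> carrier_mat (n + n) (n + n)" "H \<in> cartan n" "p < n + n" "q < n + n" for X H p q
  proof -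
    obtain d where H: "H = mat_diag (n + n) (\<lambda>p. if p < n then d p else - d (p - n))"
      using \<open>H \<in> cartan n\<close> cartan_iff by blast
    show ?thesis
      using that unfolding weight_eval_std_weight[OF H that(3,4)]
      by (simp add: H mat_diag_mult_left[OF that(1)] mat_diag_mult_right[OF that(1)])
        (auto simp: mat_diag_def algebra_simps)
  qed
  have car: "H \<in> carrier_mat (n + n) (n + n)" if "H \<in> cartan n" for H
    using that unfolding cartan_iff by auto
  have key: "(\<alpha> \<in> hdual n \<and> (\<forall>H\<in>cartan n. H * X - X * H = weight_eval n \<alpha> H \<cdot>\<^sub>m X)) \<longleftrightarrow>
    (\<forall>p<n + n. \<forall>q<n + n. X $$ (p, q) \<noteq> 0 \<longrightarrow> \<alpha> = std_weight n p - std_weight n q)"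
    (is "?L = ?R")
    if X: "X \<in> carrier_mat (n + n) (n + n)" and nz: "X \<noteq> 0\<^sub>m (n + n) (n + n)" for \<alpha> X
  proof
    assume L: ?L
    show ?R
    proof (intro allI impI)
      fix p q assume pq: "p < n + n" "q < n + n" and x: "X $$ (p, q) \<noteq> 0"
      show "\<alpha> = std_weight n p - std_weight n q"
      proof (rule weight_eval_eqD)
        fix H assume H: "H \<in> cartan n"
        have "weight_eval n (std_weight n p - std_weight n q) H * X $$ (p, q) = weight_eval n \<alpha> H * X $$ (p, q)"
          using L H X pq unfolding comm[OF X H pq, symmetric] by auto
        then show "weight_eval n \<alpha> H = weight_eval n (std_weight n p - std_weight n q) H"
          using x by simp
      qed (use L pq in \<open>auto intro: std_weight_diff_hdual\<close>)
    qed
  next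
    assume R: ?R
    obtain p q where pq: "p < n + n" "q < n + n" "X $$ (p, q) \<noteq> 0"
    proof (rule ccontr)
      assume "\<not> thesis"
      with that have "X $$ (p, q) = 0" if "p < n + n" "q < n + n" for p q
        using \<open>p < n + n\<close> \<open>q < n + n\<close> by blast
      with X have "X = 0\<^sub>m (n + n) (n + n)" by (intro eq_matI) auto
      with nz show False by simp
    qed
    then have "\<alpha> \<in> hdual n" using R std_weight_diff_hdual by blast
    moreover have "H * X - X * H = weight_eval n \<alpha> H \<cdot>\<^sub>m X" if H: "H \<in> cartan n" for H
    proof (rule eq_matI)
      fix p q assume "p < dim_row (weight_eval n \<alpha> H \<cdot>\<^sub>m X)" "q < dim_col (weight_eval n \<alpha> H \<cdot>\<^sub>m X)"
      then have pq: "p < n + n" "q < n + n" using X by auto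
      show "(H * X - X * H) $$ (p, q) = (weight_eval n \<alpha> H \<cdot>\<^sub>m X) $$ (p, q)"
        unfolding comm[OF X H pq] using R pq X by (cases "X $$ (p, q) = 0") auto
    qed (use X car[OF H] in auto)
    ultimately show ?L by blast
  qed
  have "(\<alpha> \<in> hdual n \<and> \<alpha> \<noteq> 0 \<and> (\<exists>X\<in>S. X \<noteq> 0\<^sub>m (n + n) (n + n) \<and>
        (\<forall>H\<in>cartan n. H * X - X * H = weight_eval n \<alpha> H \<cdot>\<^sub>m X))) \<longleftrightarrow>
    (\<alpha> \<noteq> 0 \<and> (\<exists>X\<in>S. X \<noteq> 0\<^sub>m (n + n) (n + n) \<and>
    (\<forall>p<n + n. \<forall>q<n + n. X $$ (p, q) \<noteq> 0 \<longrightarrow> \<alpha> = std_weight n p - std_weight n q)))" for \<alpha>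
    using key S by blast
  then show ?thesis unfolding roots_of_def by blast
qed

lemma eps_inject [simp]: "eps i = eps j \<longleftrightarrow> i = j"
proof
  assume "eps i = eps j"
  then have "coord (eps i) i = coord (eps j) i" by simp
  then show "i = j" by (simp add: coord_eps split: if_splits)
qed simp

lemma eps_add_nonzero [simp]: "eps i + eps j \<noteq> 0"
proof
  assume "eps i + eps j = 0"
  then have "coord (eps i + eps j) i = coord 0 i" by simp
  then show False by (simp add: coord_eps split: if_splits)
qed

lemma roots_of_I:
  assumes S: "S \<subseteq> carrier_mat (n + n) (n + n)" and X: "X \<in> S" and \<alpha>: "\<alpha> \<noteq> 0"
    and pq: "p < n + n" "q < n + n" "X $$ (p, q) \<noteq> 0"
    and w: "\<And>p q. p < n + n \<Longrightarrow> q < n + n \<Longrightarrow> X $$ (p, q) \<noteq> 0 \<Longrightarrow> \<alpha> = std_weight n p - std_weight n q"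
  shows "\<alpha> \<in> roots_of n S"
proof -
  have "X \<noteq> 0\<^sub>m (n + n) (n + n)"
    using pq index_zero_mat(1) by metis
  then show ?thesis
    unfolding roots_of_eq[OF S] mem_Collect_eq using X \<alpha> w by (intro conjI bexI[of _ X] allI impI) auto
qed

lemma roots_of_E:
  assumes S: "S \<subseteq> carrier_mat (n + n) (n + n)" and "\<alpha> \<in> roots_of n S"
  obtains X p q where "X \<in> S" "\<alpha> \<noteq> 0" "p < n + n" "q < n + n" "X $$ (p, q) \<noteq> 0"
    "\<alpha> = std_weight n p - std_weight n q"
proof -
  from assms(2) obtain X where \<alpha>: "\<alpha> \<noteq> 0" and X: "X \<in> S" and nz: "X \<noteq> 0\<^sub>m (n + n) (n + n)"
    and w: "\<forall>p<n + n. \<forall>q<n + n. X $$ (p, q) \<noteq> 0 \<longrightarrow> \<alpha> = std_weight n p - std_weight n q"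
    unfolding roots_of_eq[OF S] mem_Collect_eq by (elim conjE bexE) rule
  have "\<exists>p<n + n. \<exists>q<n + n. X $$ (p, q) \<noteq> 0"
  proof (rule ccontr)
    assume no: "\<not> ?thesis"
    have "X = 0\<^sub>m (n + n) (n + n)"
    proof (rule eq_matI)
      fix p q assume "p < dim_row (0\<^sub>m (n + n) (n + n) :: complex mat)"
        "q < dim_col (0\<^sub>m (n + n) (n + n) :: complex mat)"
      then show "X $$ (p, q) = 0\<^sub>m (n + n) (n + n) $$ (p, q)" using no by simp
    qed (use X S in auto)
    with nz show False by simp
  qed
  then obtain p q where pq: "p < n + n" "q < n + n" "X $$ (p, q) \<noteq> 0" by (elim exE conjE) rule
  with w have "\<alpha> = std_weight n p - std_weight n q" by simp
  with X \<alpha> pq show thesis by (rule that)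
qed

lemma four_block_index:
  assumes "A \<in> carrier_mat n n" "B \<in> carrier_mat n n" "C \<in> carrier_mat n n" "D \<in> carrier_mat n n"
    and "p < n + n" "q < n + n"
  shows "four_block_mat A B C D $$ (p, q) =
    (if p < n then if q < n then A $$ (p, q) else B $$ (p, q - n)
     else if q < n then C $$ (p - n, q) else D $$ (p - n, q - n))"
  using assms by simp

lemma lt_diff_cases:
  fixes p n :: nat
  assumes "p < n + n"
  obtains "p < n" | k where "p = k + n" "k < n"
proof (cases "p < n")
  case False
  then have "p = (p - n) + n" "p - n < n" using assms by simp_all
  then show thesis by (rule that(2))
qed (rule that(1))

lemma std_weight_simps:
  "p < n \<Longrightarrow> std_weight n p = eps (p + 1)"
  "std_weight n (p + n) = - eps (p + 1)"
  by (simp_all add: std_weight_def)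

lemma roots_of_periplectic_0:
  "roots_of n (periplectic_0 n) = {eps i - eps j | i j. i \<in> {1..n} \<and> j \<in> {1..n} \<and> i \<noteq> j}"
  (is "_ = ?R")
proof -
  have S: "periplectic_0 n \<subseteq> carrier_mat (n + n) (n + n)"
    by (auto simp: periplectic_0_def)
  have R: "eps (k + 1) - eps (l + 1) \<in> ?R" if "k < n" "l < n" "eps (k + 1) - eps (l + 1) \<noteq> 0" for k l
  proof -
    have "k \<noteq> l" using that(3) by (metis diff_self)
    then show ?thesis
      using that(1,2) by (intro CollectI exI[of _ "k + 1"] exI[of _ "l + 1"]) simp
  qed
  show ?thesis
  proof (intro equalityI subsetI)
    fix \<alpha> assume "\<alpha> \<in> roots_of n (periplectic_0 n)"
    then obtain X p q where X: "X \<in> periplectic_0 n" and nz: "\<alpha> \<noteq> 0"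
      and pq: "p < n + n" "q < n + n" and x: "X $$ (p, q) \<noteq> 0" and w: "\<alpha> = std_weight n p - std_weight n q"
      by (rule roots_of_E[OF S])
    from X obtain A where A: "A \<in> carrier_mat n n"
      and XA: "X = four_block_mat A (0\<^sub>m n n) (0\<^sub>m n n) (- A\<^sup>T)"
      unfolding periplectic_0_def by (elim CollectE exE conjE) rule
    have x': "(if p < n then if q < n then A $$ (p, q) else 0\<^sub>m n n $$ (p, q - n)
      else if q < n then 0\<^sub>m n n $$ (p - n, q) else (- A\<^sup>T) $$ (p - n, q - n)) \<noteq> 0"
      using x unfolding XA by (subst (asm) four_block_index[where n = n]) (use A pq in auto)
    show "\<alpha> \<in> ?R"
    proof (cases rule: lt_diff_cases[OF pq(1)])
      case p: 1
      then have "q < n" using x' pq by (auto split: if_splits)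
      with p show ?thesis using w R[of p q] nz by (simp add: std_weight_simps)
    next
      case p: (2 k)
      then have "\<not> q < n" using x' by auto
      then obtain l where l: "q = l + n" "l < n" using lt_diff_cases[OF pq(2)] by metis
      with p show ?thesis using w R[of l k] nz by (simp add: std_weight_simps)
    qed
  next
    fix \<alpha> assume "\<alpha> \<in> ?R"
    then obtain i j where ij': "i \<in> {1..n}" "j \<in> {1..n}" "i \<noteq> j" and \<alpha>': "\<alpha> = eps i - eps j"
      by (elim CollectE exE conjE) rule
    define k where "k = i - 1"
    define l where "l = j - 1"
    have kl: "k < n" "l < n" "k \<noteq> l" and \<alpha>: "\<alpha> = eps (k + 1) - eps (l + 1)"
      using ij' by (auto simp: k_def l_def \<alpha>')
    define A where "A = mat n n (\<lambda>(p, q). if p = k \<and> q = l then 1 else 0 :: complex)"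
    have A: "A \<in> carrier_mat n n" by (simp add: A_def)
    have Ai: "A $$ (p, q) = (if p = k \<and> q = l then 1 else 0)" if "p < n" "q < n" for p q
      using that by (simp add: A_def)
    define X where "X = four_block_mat A (0\<^sub>m n n) (0\<^sub>m n n) (- A\<^sup>T)"
    have X: "X $$ (p, q) = (if p < n then if q < n then A $$ (p, q) else 0
      else if q < n then 0 else - A $$ (q - n, p - n))" if "p < n + n" "q < n + n" for p q
      unfolding X_def by (subst four_block_index[where n = n]) (use A that in auto)
    show "\<alpha> \<in> roots_of n (periplectic_0 n)"
    proof (rule roots_of_I[OF S])
      show "X \<in> periplectic_0 n"
        unfolding X_def periplectic_0_def using A by blast
      show "\<alpha> \<noteq> 0" using kl by (simp add: \<alpha>)
      show "k < n + n" "l < n + n" using kl by simp_all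
      then show "X $$ (k, l) \<noteq> 0" using kl by (simp add: X Ai)
      fix p q assume pq: "p < n + n" "q < n + n" and x: "X $$ (p, q) \<noteq> 0"
      show "\<alpha> = std_weight n p - std_weight n q"
      proof (cases rule: lt_diff_cases[OF pq(1)])
        case p: 1
        then have q: "q < n" using x pq by (auto simp: X split: if_splits)
        have "p = k \<and> q = l"
          using x unfolding X[OF pq] using p q by (auto simp: Ai split: if_splits)
        then show ?thesis using p q by (simp add: \<alpha> std_weight_simps)
      next
        case p: (2 p')
        then have "\<not> q < n" using x unfolding X[OF pq] by auto
        then obtain q' where q: "q = q' + n" "q' < n" using lt_diff_cases[OF pq(2)] by metis
        have "p' = l \<and> q' = k"
          using x unfolding X[OF pq] using p q by (auto simp: Ai split: if_splits)
        then show ?thesis using p q by (simp add: \<alpha> std_weight_simps)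
      qed
    qed
  qed
qed

lemma roots_of_periplectic_1:
  "roots_of n (periplectic_1 n) = {eps i + eps j | i j. 1 \<le> i \<and> i \<le> j \<and> j \<le> n}"
  (is "_ = ?R")
proof -
  have S: "periplectic_1 n \<subseteq> carrier_mat (n + n) (n + n)"
    by (auto simp: periplectic_1_def)
  show ?thesis
  proof (intro equalityI subsetI)
    fix \<alpha> assume "\<alpha> \<in> roots_of n (periplectic_1 n)"
    then obtain X p q where X: "X \<in> periplectic_1 n"
      and pq: "p < n + n" "q < n + n" and x: "X $$ (p, q) \<noteq> 0" and w: "\<alpha> = std_weight n p - std_weight n q"
      by (rule roots_of_E[OF S])
    from X obtain B where B: "B \<in> carrier_mat n n"
      and XB: "X = four_block_mat (0\<^sub>m n n) B (0\<^sub>m n n) (0\<^sub>m n n)"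
      unfolding periplectic_1_def by (elim CollectE exE conjE) rule
    have "X $$ (p, q) = (if p < n \<and> \<not> q < n then B $$ (p, q - n) else 0)"
      unfolding XB by (subst four_block_index[where n = n]) (use B pq in auto)
    with x have p: "p < n" and "\<not> q < n" by (auto split: if_splits)
    then obtain l where q: "q = l + n" "l < n" using lt_diff_cases[OF pq(2)] by metis
    have "\<alpha> = eps (p + 1) + eps (l + 1)"
      unfolding w q(1) std_weight_simps(1)[OF p] std_weight_simps(2) by simp
    then have "\<alpha> = eps (min p l + 1) + eps (max p l + 1)"
      by (cases "p \<le> l") (simp_all add: min_def max_def add.commute)
    then show "\<alpha> \<in> ?R"
      using p q by (intro CollectI exI[of _ "min p l + 1"] exI[of _ "max p l + 1"] conjI) auto
  next
    fix \<alpha> assume "\<alpha> \<in> ?R"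
    then obtain i j where ij: "1 \<le> i" "i \<le> j" "j \<le> n" and \<alpha>': "\<alpha> = eps i + eps j"
      by (elim CollectE exE conjE) rule
    define k where "k = i - 1"
    define l where "l = j - 1"
    have kl: "k < n" "l < n" and \<alpha>: "\<alpha> = eps (k + 1) + eps (l + 1)"
      using ij by (auto simp: k_def l_def \<alpha>')
    define B where "B = mat n n (\<lambda>(p, q). if p = k \<and> q = l \<or> p = l \<and> q = k then 1 else 0 :: complex)"
    have B: "B \<in> carrier_mat n n" by (simp add: B_def)
    have Bi: "B $$ (p, q) = (if p = k \<and> q = l \<or> p = l \<and> q = k then 1 else 0)" if "p < n" "q < n" for p q
      using that by (simp add: B_def)
    have BT: "B\<^sup>T = B"
    proof (rule eq_matI)
      fix p q assume "p < dim_row B" "q < dim_col B"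
      then have "p < n" "q < n" using B by auto
      then show "B\<^sup>T $$ (p, q) = B $$ (p, q)" using B by (auto simp: Bi)
    qed (use B in auto)
    define X where "X = four_block_mat (0\<^sub>m n n) B (0\<^sub>m n n) (0\<^sub>m n n)"
    have X: "X $$ (p, q) = (if p < n \<and> \<not> q < n then B $$ (p, q - n) else 0)"
      if "p < n + n" "q < n + n" for p q
      unfolding X_def by (subst four_block_index[where n = n]) (use B that in auto)
    show "\<alpha> \<in> roots_of n (periplectic_1 n)"
    proof (rule roots_of_I[OF S])
      show "X \<in> periplectic_1 n"
        unfolding X_def periplectic_1_def using B BT by blast
      show "\<alpha> \<noteq> 0" unfolding \<alpha> by (rule eps_add_nonzero)
      show "k < n + n" "l + n < n + n" using kl by simp_all
      then show "X $$ (k, l + n) \<noteq> 0" using kl by (simp add: X Bi)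
      fix p q assume pq: "p < n + n" "q < n + n" and x: "X $$ (p, q) \<noteq> 0"
      from x have p: "p < n" and "\<not> q < n" unfolding X[OF pq] by (auto split: if_splits)
      then obtain q' where q: "q = q' + n" "q' < n" using lt_diff_cases[OF pq(2)] by metis
      have "p = k \<and> q' = l \<or> p = l \<and> q' = k"
        using x unfolding X[OF pq] using p q by (simp add: Bi split: if_splits)
      moreover have "std_weight n p - std_weight n q = eps (p + 1) + eps (q' + 1)"
        unfolding q(1) std_weight_simps(1)[OF p] std_weight_simps(2) by simp
      ultimately show "\<alpha> = std_weight n p - std_weight n q"
        by (elim disjE) (simp_all add: \<alpha> add.commute)
    qed
  qed
qed

lemma roots_of_periplectic_m1:
  "roots_of n (periplectic_m1 n) = {- (eps i + eps j) | i j. 1 \<le> i \<and> i < j \<and> j \<le> n}"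
  (is "_ = ?R")
proof -
  have S: "periplectic_m1 n \<subseteq> carrier_mat (n + n) (n + n)"
    by (auto simp: periplectic_m1_def)
  have sw: "std_weight n (p + n) - std_weight n q = - (eps (p + 1) + eps (q + 1))" if "q < n" for p q
    unfolding std_weight_simps(1)[OF that] std_weight_simps(2) by simp
  show ?thesis
  proof (intro equalityI subsetI)
    fix \<alpha> assume "\<alpha> \<in> roots_of n (periplectic_m1 n)"
    then obtain X p q where X: "X \<in> periplectic_m1 n"
      and pq: "p < n + n" "q < n + n" and x: "X $$ (p, q) \<noteq> 0" and w: "\<alpha> = std_weight n p - std_weight n q"
      by (rule roots_of_E[OF S])
    from X obtain C where C: "C \<in> carrier_mat n n" and sk: "C\<^sup>T = - C"
      and XC: "X = four_block_mat (0\<^sub>m n n) (0\<^sub>m n n) C (0\<^sub>m n n)"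
      unfolding periplectic_m1_def by (elim CollectE exE conjE) rule
    have Xi: "X $$ (p, q) = (if q < n \<and> \<not> p < n then C $$ (p - n, q) else 0)"
      unfolding XC by (subst four_block_index[where n = n]) (use C pq in auto)
    with x have q: "q < n" and "\<not> p < n" by (auto split: if_splits)
    then obtain k where p: "p = k + n" "k < n" using lt_diff_cases[OF pq(1)] by metis
    have "C $$ (k, q) \<noteq> 0" using x Xi p q by simp
    moreover have "C $$ (k, k) = 0"
    proof -
      have "C $$ (k, k) = C\<^sup>T $$ (k, k)" using p C by simp
      also have "\<dots> = - C $$ (k, k)" using p C unfolding sk by simp
      finally show ?thesis by simp
    qed
    ultimately have "k \<noteq> q" by auto
    have "\<alpha> = - (eps (k + 1) + eps (q + 1))"
      unfolding w p(1) by (rule sw[OF q])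
    then have "\<alpha> = - (eps (min k q + 1) + eps (max k q + 1))"
      by (cases "k \<le> q") (simp_all add: min_def max_def add.commute)
    then show "\<alpha> \<in> ?R"
      using p q \<open>k \<noteq> q\<close>
      by (intro CollectI exI[of _ "min k q + 1"] exI[of _ "max k q + 1"] conjI) auto
  next
    fix \<alpha> assume "\<alpha> \<in> ?R"
    then obtain i j where ij: "1 \<le> i" "i < j" "j \<le> n" and \<alpha>': "\<alpha> = - (eps i + eps j)"
      by (elim CollectE exE conjE) rule
    define k where "k = i - 1"
    define l where "l = j - 1"
    have kl: "k < n" "l < n" "k \<noteq> l" and ij': "i = k + 1" "j = l + 1"
      using ij by (auto simp: k_def l_def)
    have \<alpha>: "\<alpha> = - (eps (k + 1) + eps (l + 1))"
      unfolding \<alpha>' ij' ..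
    define C where "C = mat n n (\<lambda>(p, q). if p = k \<and> q = l then 1
      else if p = l \<and> q = k then - 1 else 0 :: complex)"
    have C: "C \<in> carrier_mat n n" by (simp add: C_def)
    have Ci: "C $$ (p, q) = (if p = k \<and> q = l then 1 else if p = l \<and> q = k then - 1 else 0)"
      if "p < n" "q < n" for p q
      using that by (simp add: C_def)
    have CT: "C\<^sup>T = - C"
    proof (rule eq_matI)
      fix p q assume "p < dim_row (- C)" "q < dim_col (- C)"
      then have "p < n" "q < n" using C by auto
      then show "C\<^sup>T $$ (p, q) = (- C) $$ (p, q)" using C kl(3) by (auto simp: Ci)
    qed (use C in auto)
    define X where "X = four_block_mat (0\<^sub>m n n) (0\<^sub>m n n) C (0\<^sub>m n n)"
    have X: "X $$ (p, q) = (if q < n \<and> \<not> p < n then C $$ (p - n, q) else 0)"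
      if "p < n + n" "q < n + n" for p q
      unfolding X_def by (subst four_block_index[where n = n]) (use C that in auto)
    show "\<alpha> \<in> roots_of n (periplectic_m1 n)"
    proof (rule roots_of_I[OF S])
      show "X \<in> periplectic_m1 n"
        unfolding X_def periplectic_m1_def using C CT by blast
      show "\<alpha> \<noteq> 0" unfolding \<alpha> neg_equal_0_iff_equal by (rule eps_add_nonzero)
      show "k + n < n + n" "l < n + n" using kl by simp_all
      then show "X $$ (k + n, l) \<noteq> 0" using kl by (simp add: X Ci)
      fix p q assume pq: "p < n + n" "q < n + n" and x: "X $$ (p, q) \<noteq> 0"
      from x have q: "q < n" and "\<not> p < n" unfolding X[OF pq] by (auto split: if_splits)
      then obtain p' where p: "p = p' + n" "p' < n" using lt_diff_cases[OF pq(1)] by metis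
      have "p' = k \<and> q = l \<or> p' = l \<and> q = k"
        using x unfolding X[OF pq] using p q by (simp add: Ci split: if_splits)
      then show "\<alpha> = std_weight n p - std_weight n q"
        unfolding p(1) sw[OF q] by (elim disjE) (simp_all add: \<alpha> add.commute)
    qed
  qed
qed

definition pos_even_roots :: "nat \<Rightarrow> weight set" where
  "pos_even_roots n = {eps i - eps j | i j. 1 \<le> i \<and> i < j \<and> j \<le> n}"

definition pos_odd_roots :: "nat \<Rightarrow> weight set" where
  "pos_odd_roots n = roots_of n (periplectic_m1 n)"

definition rho :: "nat \<Rightarrow> weight" where
  "rho n = (\<Sum>i = 1..n. scale (of_nat (n - i)) (eps i))"

definition beta :: "nat \<Rightarrow> weight" where
  "beta k = - (eps (2 * k - 1) + eps (2 * k))"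

lemma coord_rho: "coord (rho n) i = (if i \<in> {1..n} then of_nat (n - i) else 0)"
  unfolding rho_def by (simp add: coord_sum coord_eps if_distrib cong: if_cong)

definition pairs_less :: "nat \<Rightarrow> (nat \<times> nat) set" where
  "pairs_less n = {(i, j). 1 \<le> i \<and> i < j \<and> j \<le> n}"

lemma pos_even_roots_image: "pos_even_roots n = (\<lambda>(i, j). eps i - eps j) ` pairs_less n"
  by (auto simp: pos_even_roots_def pairs_less_def)

lemma pos_odd_roots_image: "pos_odd_roots n = (\<lambda>(i, j). - (eps i + eps j)) ` pairs_less n"
  by (auto simp: pos_odd_roots_def roots_of_periplectic_m1 pairs_less_def)

lemma inj_on_even: "inj_on (\<lambda>(i, j). eps i - eps j) (pairs_less n)"
proof (rule inj_onI, clarify)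
  fix i j k l assume ij: "(i, j) \<in> pairs_less n" and eq: "eps i - eps j = eps k - eps l"
  have "i \<noteq> j" using ij by (simp add: pairs_less_def)
  have c: "coord (eps i) m - coord (eps j) m = coord (eps k) m - coord (eps l) m" for m
    using arg_cong[OF eq, of "\<lambda>u. coord u m"] by (simp only: coord_simps)
  have "i = k"
  proof (rule ccontr)
    assume "i \<noteq> k"
    with c[of i] \<open>i \<noteq> j\<close> show False by (cases "l = i") (simp_all add: coord_eps)
  qed
  moreover have "j = l"
  proof (rule ccontr)
    assume "j \<noteq> l"
    with c[of j] \<open>i \<noteq> j\<close> show False by (cases "k = j") (simp_all add: coord_eps)
  qed
  ultimately show "i = k \<and> j = l" by simp
qed

lemma inj_on_odd: "inj_on (\<lambda>(i, j). - (eps i + eps j)) (pairs_less n)"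
proof (rule inj_onI, clarify)
  fix i j k l assume "(i, j) \<in> pairs_less n" "(k, l) \<in> pairs_less n"
    and eq: "- (eps i + eps j) = - (eps k + eps l)"
  then have lt: "i < j" "k < l" by (simp_all add: pairs_less_def)
  have c: "coord (eps i) m + coord (eps j) m = coord (eps k) m + coord (eps l) m" for m
    using arg_cong[OF eq, of "\<lambda>u. coord (- u) m"] by (simp only: coord_simps minus_minus)
  have "i = k \<or> i = l"
  proof (rule ccontr)
    assume "\<not> ?thesis"
    with c[of i] lt show False by (simp add: coord_eps)
  qed
  moreover have "j = k \<or> j = l"
  proof (rule ccontr)
    assume "\<not> ?thesis"
    with c[of j] lt show False by (simp add: coord_eps)
  qed
  ultimately show "i = k \<and> j = l" using lt by linarith
qed

text \<open>\<open>rho\<close> is the half-sum of the positive even roots minus that of the positive odd roots.\<close>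

lemma rho_half_sums:
  "rho n = scale (1 / 2) (\<Sum>\<alpha>\<in>pos_even_roots n. \<alpha>) - scale (1 / 2) (\<Sum>\<alpha>\<in>pos_odd_roots n. \<alpha>)"
proof (rule weight_eqI)
  fix k
  have pairs: "pairs_less n = Sigma {1..n} (\<lambda>i. {i<..n})"
    by (auto simp: pairs_less_def)
  have "coord (scale (1 / 2) (\<Sum>\<alpha>\<in>pos_even_roots n. \<alpha>) - scale (1 / 2) (\<Sum>\<alpha>\<in>pos_odd_roots n. \<alpha>)) k =
    (1 / 2) * (\<Sum>(i, j)\<in>pairs_less n. coord (eps i - eps j) k)
    - (1 / 2) * (\<Sum>(i, j)\<in>pairs_less n. coord (- (eps i + eps j)) k)"
    unfolding pos_even_roots_image pos_odd_roots_image sum.reindex[OF inj_on_even]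
      sum.reindex[OF inj_on_odd] by (simp only: coord_simps coord_scale coord_sum o_def case_prod_unfold)
  also have "\<dots> = (\<Sum>(i, j)\<in>pairs_less n. coord (eps i) k)"
    unfolding sum_distrib_left sum_subtractf[symmetric]
    by (intro sum.cong refl) (auto simp: field_simps)
  also have "\<dots> = (\<Sum>i = 1..n. of_nat (n - i) * coord (eps i) k)"
    unfolding pairs by (subst sum.Sigma[symmetric]) auto
  also have "\<dots> = coord (rho n) k"
    by (simp add: rho_def coord_sum)
  finally show "coord (rho n) k = coord (scale (1 / 2) (\<Sum>\<alpha>\<in>pos_even_roots n. \<alpha>) - scale (1 / 2) (\<Sum>\<alpha>\<in>pos_odd_roots n. \<alpha>)) k"
    by simp
qed

section \<open>Formal exponentials\<close>

text \<open>
  The field of fractions of the group algebra of the additive group of weights.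
\<close>

type_synonym expfield = "(weight \<Rightarrow>\<^sub>0 complex) fract"

definition fexp :: "weight \<Rightarrow> expfield" where
  "fexp l = Fract (Poly_Mapping.single l 1) 1"

lemma fexp_0: "fexp 0 = 1"
  by (simp add: fexp_def One_fract_def single_one)

lemma fexp_add: "fexp (u + v) = fexp u * fexp v"
  by (simp add: fexp_def mult_single)

lemma fexp_inject: "fexp u = fexp v \<longleftrightarrow> u = v"
proof
  assume "fexp u = fexp v"
  then have "Poly_Mapping.single u (1::complex) = Poly_Mapping.single v 1"
    by (simp add: fexp_def eq_fract)
  then have "Poly_Mapping.lookup (Poly_Mapping.single u (1::complex)) u = Poly_Mapping.lookup (Poly_Mapping.single v 1) u"
    by simp
  then show "u = v"
    by (simp add: lookup_single when_def split: if_splits)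
qed simp

definition denom_R :: "nat \<Rightarrow> expfield" where
  "denom_R n = (\<Prod>\<alpha>\<in>pos_even_roots n. 1 - fexp (- \<alpha>)) / (\<Prod>\<alpha>\<in>pos_odd_roots n. 1 - fexp (- \<alpha>))"

lemma denom_R_explicit:
  "denom_R n = (\<Prod>(i, j)\<in>pairs_less n. 1 - fexp (- (eps i - eps j))) /
    (\<Prod>(i, j)\<in>pairs_less n. 1 - fexp (eps i + eps j))"
  unfolding denom_R_def pos_even_roots_image pos_odd_roots_image
    prod.reindex[OF inj_on_even] prod.reindex[OF inj_on_odd]
  by (simp only: o_def case_prod_unfold minus_minus)

section \<open>Action of permutations\<close>

text \<open>
  \<open>w(eps i) = eps (w i)\<close> means that the \<open>i\<close>-th coordinate of \<open>w l\<close> is the \<open>w\<inverse>(i)\<close>-th coordinate of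
  \<open>l\<close>. Functions that are not bijections act trivially, which makes every map an automorphism and
  so lets the action be lifted to fractions; they never occur as elements of the Weyl group.
\<close>

lift_definition wt_act :: "(nat \<Rightarrow> nat) \<Rightarrow> weight \<Rightarrow> weight"
  is "\<lambda>w l. if bij w then Poly_Mapping.map_key (inv_into UNIV w) l else l" .

lemma coord_wt_act: "bij w \<Longrightarrow> coord (wt_act w l) i = coord l (inv_into UNIV w i)"
  by transfer (simp add: map_key.rep_eq bij_imp_bij_inv bij_is_inj)

lemma wt_act_eps: "bij w \<Longrightarrow> wt_act w (eps i) = eps (w i)"
  by (rule weight_eqI) (auto simp: coord_wt_act coord_eps bij_inv_eq_iff dest: bij_inv_eq_iff)

lemma wt_act_not_bij: "\<not> bij w \<Longrightarrow> wt_act w l = l"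
  by transfer simp

lemma wt_act_add: "wt_act w (u + v) = wt_act w u + wt_act w v"
  by (cases "bij w") (auto simp: wt_act_not_bij coord_wt_act intro: weight_eqI)

lemma wt_act_0: "wt_act w 0 = 0"
  by (cases "bij w") (auto simp: wt_act_not_bij coord_wt_act intro: weight_eqI)

lemma wt_act_inv: "bij w \<Longrightarrow> wt_act (inv_into UNIV w) (wt_act w l) = l"
  by (rule weight_eqI) (simp add: coord_wt_act bij_imp_bij_inv inv_inv_eq bij_is_inj)

lemma wt_act_inv_right:
  assumes "bij w"
  shows "wt_act w (wt_act (inv_into UNIV w) l) = l"
  using wt_act_inv[OF bij_imp_bij_inv[OF assms], of l] by (simp only: inv_inv_eq[OF assms])

lemma bij_wt_act: "bij (wt_act w)"
proof (cases "bij w")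
  case True
  show ?thesis
  proof (rule o_bij)
    show "wt_act (inv_into UNIV w) \<circ> wt_act w = id"
      by (rule ext) (simp only: o_apply id_apply wt_act_inv[OF True])
    show "wt_act w \<circ> wt_act (inv_into UNIV w) = id"
      by (rule ext) (simp only: o_apply id_apply wt_act_inv_right[OF True])
  qed
next
  case False
  have "wt_act w = id" by (rule ext) (simp only: id_apply wt_act_not_bij[OF False])
  then show ?thesis by simp
qed

lemmas inj_wt_act = bij_is_inj[OF bij_wt_act]

definition alg_act :: "(nat \<Rightarrow> nat) \<Rightarrow> (weight \<Rightarrow>\<^sub>0 complex) \<Rightarrow> (weight \<Rightarrow>\<^sub>0 complex)" where
  "alg_act w f = Poly_Mapping.map_key (wt_act (inv_into UNIV w)) f"

lemma lookup_alg_act: "Poly_Mapping.lookup (alg_act w f) l = Poly_Mapping.lookup f (wt_act (inv_into UNIV w) l)"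
  by (simp add: alg_act_def map_key.rep_eq inj_wt_act)

lemma alg_act_single:
  assumes "bij w"
  shows "alg_act w (Poly_Mapping.single l c) = Poly_Mapping.single (wt_act w l) c"
proof (rule poly_mapping_eqI)
  fix m
  have "l = wt_act (inv_into UNIV w) m \<longleftrightarrow> wt_act w l = m"
  proof
    assume "l = wt_act (inv_into UNIV w) m"
    then show "wt_act w l = m" by (simp only: wt_act_inv_right[OF assms])
  next
    assume "wt_act w l = m"
    then have "wt_act (inv_into UNIV w) m = wt_act (inv_into UNIV w) (wt_act w l)" by (rule arg_cong[OF sym])
    then show "l = wt_act (inv_into UNIV w) m" by (simp only: wt_act_inv[OF assms])
  qed
  then show "Poly_Mapping.lookup (alg_act w (Poly_Mapping.single l c)) m =
    Poly_Mapping.lookup (Poly_Mapping.single (wt_act w l) c) m"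
    by (simp only: lookup_alg_act lookup_single)
qed

lemma alg_act_add: "alg_act w (f + g) = alg_act w f + alg_act w g"
  by (rule poly_mapping_eqI) (simp add: lookup_alg_act lookup_add)

lemma alg_act_0 [simp]: "alg_act w 0 = 0"
  by (rule poly_mapping_eqI) (simp add: lookup_alg_act)

lemma alg_act_1 [simp]: "alg_act w 1 = 1"
proof (rule poly_mapping_eqI)
  fix m
  have "wt_act (inv_into UNIV w) m = 0 \<longleftrightarrow> m = 0"
    using inj_eq[OF inj_wt_act, of "inv_into UNIV w" m 0] by (simp only: wt_act_0)
  then show "Poly_Mapping.lookup (alg_act w 1) m = Poly_Mapping.lookup 1 m"
    by (simp only: lookup_alg_act lookup_one)
qed

lemma alg_act_eq_0_iff [simp]: "alg_act w f = 0 \<longleftrightarrow> f = 0"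
proof
  assume *: "alg_act w f = 0"
  show "f = 0"
  proof (rule poly_mapping_eqI)
    fix l
    obtain m where m: "l = wt_act (inv_into UNIV w) m"
      by (rule surjE[OF bij_is_surj[OF bij_wt_act]])
    have "Poly_Mapping.lookup f l = Poly_Mapping.lookup (alg_act w f) m"
      by (simp only: m lookup_alg_act)
    then show "Poly_Mapping.lookup f l = Poly_Mapping.lookup 0 l"
      by (simp only: * lookup_zero)
  qed
next
  assume "f = 0"
  then show "alg_act w f = 0" by (simp only: alg_act_0)
qed

lemma poly_mapping_sum_induct:
  fixes f :: "'a \<Rightarrow>\<^sub>0 'b :: comm_monoid_add"
  assumes "P 0" and "\<And>a b f. P f \<Longrightarrow> P (Poly_Mapping.single a b + f)"
  shows "P f"
proof (induction f rule: Poly_Mapping.update_induct)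
  case (update f a b)
  then have "Poly_Mapping.update a b f = Poly_Mapping.single a b + f"
    by (intro poly_mapping_eqI) (auto simp: lookup_update lookup_add lookup_single when_def in_keys_iff)
  then show ?case using update assms(2) by simp
qed (rule assms(1))

lemma alg_act_mult: "alg_act w (f * g) = alg_act w f * alg_act w g"
proof -
  define h where "h = wt_act (inv_into UNIV w)"
  have bij: "bij h" and add: "h (u + v) = h u + h v" for u v
    by (simp_all add: h_def bij_wt_act wt_act_add)
  have single: "Poly_Mapping.map_key h (Poly_Mapping.single (h l) c) = Poly_Mapping.single l c"
    for l and c :: complex
    using bij by (intro map_key_single) (simp add: bij_is_inj)
  have aux: "Poly_Mapping.map_key h (Poly_Mapping.single a c * Poly_Mapping.single b d) =
    Poly_Mapping.map_key h (Poly_Mapping.single a c) * Poly_Mapping.map_key h (Poly_Mapping.single b d)"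
    for a b and c d :: complex
  proof -
    obtain a' where "a = h a'" by (rule surjE[OF bij_is_surj[OF bij]])
    moreover obtain b' where "b = h b'" by (rule surjE[OF bij_is_surj[OF bij]])
    ultimately show ?thesis by (simp only: mult_single single add[symmetric])
  qed
  have plus: "Poly_Mapping.map_key h (p + q) = Poly_Mapping.map_key h p + Poly_Mapping.map_key h q"
    for p q :: "weight \<Rightarrow>\<^sub>0 complex"
    using bij by (intro map_key_plus) (simp add: bij_is_inj)
  have zero: "Poly_Mapping.map_key h (0 :: weight \<Rightarrow>\<^sub>0 complex) = 0"
    using alg_act_0[of w] by (simp add: alg_act_def h_def)
  have left: "Poly_Mapping.map_key h (Poly_Mapping.single a c * g) =
    Poly_Mapping.map_key h (Poly_Mapping.single a c) * Poly_Mapping.map_key h g" for a c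
    by (induction g rule: poly_mapping_sum_induct) (simp_all add: aux plus zero distrib_left)
  have "Poly_Mapping.map_key h (f * g) = Poly_Mapping.map_key h f * Poly_Mapping.map_key h g"
    by (induction f rule: poly_mapping_sum_induct) (simp_all add: left plus zero distrib_right)
  then show ?thesis by (simp add: alg_act_def h_def)
qed

lift_definition W_act :: "(nat \<Rightarrow> nat) \<Rightarrow> expfield \<Rightarrow> expfield"
  is "\<lambda>w q. (alg_act w (fst q), alg_act w (snd q))"
  by (auto simp flip: alg_act_mult)

lemma W_act_Fract: "W_act w (Fract a b) = Fract (alg_act w a) (alg_act w b)"
  by transfer simp

lemma W_act_fexp: "bij w \<Longrightarrow> W_act w (fexp l) = fexp (wt_act w l)"
  by (simp add: fexp_def W_act_Fract alg_act_single)

lemma W_act_0: "W_act w 0 = 0" and W_act_1: "W_act w 1 = 1"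
  by (simp_all add: Zero_fract_def One_fract_def W_act_Fract)

lemma W_act_add: "W_act w (x + y) = W_act w x + W_act w y"
  by (cases x; cases y) (simp add: W_act_Fract alg_act_add alg_act_mult)

lemma W_act_mult: "W_act w (x * y) = W_act w x * W_act w y"
  by (cases x; cases y) (simp add: W_act_Fract alg_act_mult)

lemma W_act_divide: "W_act w (x / y) = W_act w x / W_act w y"
  by (cases x; cases y) (simp add: W_act_Fract alg_act_mult)

end

theory Submission
  imports Defs
begin

text \<open>
  With \<open>x i = fexp (eps i)\<close> the identity reads
  \<open>(\<Prod>i<j. (x i - x j) / (1 - x i * x j)) = (\<Sum>w. sgn w * w (x\<^sup>\<rho> / (\<Prod>k. 1 - x 1 * \<dots> * x (2 * k))))\<close>
  and is proved by induction on \<open>n\<close> for arbitrary elements of a field. Grouping the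
  permutations by the value \<open>b = w n\<close>, the induction hypothesis and the antisymmetry of the left
  side reduce the induction step to
  \<open>(\<Sum>b. \<Prod>i\<noteq>b. x i * (1 - x i * x b) / (x i - x b)) = 1 - x 1 * \<dots> * x n\<close> for even \<open>n\<close>, and \<open>= 1\<close> for
  odd \<open>n\<close>. This is the sum of the residues of
  \<open>(\<Prod>i. 1 - x i * z) / (z * (1 - z\<^sup>2) * (\<Prod>i. x i - z))\<close>, that is, the vanishing of a divided
  difference over the nodes \<open>0, 1, -1, x 1, \<dots>, x n\<close>.
\<close>

section \<open>Divided differences and the residue sum\<close>

text \<open>A divided difference kills every polynomial whose degree is at least two below the
  number of nodes. The factors \<open>1 - c i * z\<close> are peeled off one at a time, each at the
  cost of one node.\<close>

lemma divided_difference_prod_eq_0: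
  fixes B :: "'a :: field set"
  assumes "finite I" "finite B" "card I + 2 \<le> card B"
  shows "(\<Sum>b\<in>B. (\<Prod>i\<in>I. 1 - c i * b) / (\<Prod>d\<in>B - {b}. b - d)) = 0"
proof -
  \<comment> \<open>Multiplying by \<open>b - a\<close> kills the term at \<open>a\<close> and
    cancels one factor in all others, so the node \<open>a\<close> disappears.\<close>
  have step: "(\<Sum>b\<in>B. (b - a) * f b / (\<Prod>d\<in>B - {b}. b - d)) =
      (\<Sum>b\<in>B - {a}. f b / (\<Prod>d\<in>B - {a} - {b}. b - d))"
    if "finite B" "a \<in> B" for B :: "'a set" and a f
  proof -
    have "(\<Sum>b\<in>B. (b - a) * f b / (\<Prod>d\<in>B - {b}. b - d)) =
        (\<Sum>b\<in>B - {a}. (b - a) * f b / (\<Prod>d\<in>B - {b}. b - d))"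
      using that by (simp add: sum.remove)
    also have "\<dots> = (\<Sum>b\<in>B - {a}. f b / (\<Prod>d\<in>B - {a} - {b}. b - d))"
    proof (intro sum.cong refl)
      fix b assume b: "b \<in> B - {a}"
      then have "(\<Prod>d\<in>B - {b}. b - d) = (b - a) * (\<Prod>d\<in>B - {b} - {a}. b - d)"
        using that by (intro prod.remove) auto
      moreover have "B - {b} - {a} = B - {a} - {b}" by auto
      ultimately show "(b - a) * f b / (\<Prod>d\<in>B - {b}. b - d) = f b / (\<Prod>d\<in>B - {a} - {b}. b - d)"
        using b by simp
    qed
    finally show ?thesis .
  qed
  have base: "(\<Sum>b\<in>B. 1 / (\<Prod>d\<in>B - {b}. b - d)) = 0"
    if "finite B" "2 \<le> card B" for B :: "'a set"
    using that
  proof (induction "card B" arbitrary: B rule: less_induct)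
    case less
    obtain u v where uv: "u \<in> B" "v \<in> B" "u \<noteq> v"
      using less.prems by (metis card_le_Suc0_iff_eq not_less_eq_eq numeral_2_eq_2)
    define S where "S B = (\<Sum>b\<in>B. 1 / (\<Prod>d\<in>B - {b}. b - d))" for B :: "'a set"
    \<comment> \<open>Newton's recurrence: split \<open>v - u\<close> as
      \<open>(b - u) - (b - v)\<close> in the term at \<open>b\<close>, and let each part remove one
      node.\<close>
    have "(v - u) * S B = (\<Sum>b\<in>B. (b - u) * 1 / (\<Prod>d\<in>B - {b}. b - d)) - (\<Sum>b\<in>B. (b - v) * 1 / (\<Prod>d\<in>B - {b}. b - d))"
      unfolding S_def sum_distrib_left sum_subtractf[symmetric]
      by (intro sum.cong refl) (simp add: diff_divide_distrib)
    also have "\<dots> = S (B - {u}) - S (B - {v})"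
      unfolding S_def using less.prems uv by (simp only: step)
    also have "\<dots> = 0"
    \<comment> \<open>With two nodes the induction hypothesis is out of reach, but both one-node
      sums equal 1 and cancel.\<close>
    proof (cases "card B = 2")
      case True
      then have "B = {u, v}" using uv less.prems
        by (metis card_2_iff doubleton_eq_iff insertE singletonD)
      then have "B - {u} = {v}" "B - {v} = {u}" using uv by auto
      then show ?thesis by (simp add: S_def)
    next
      case False
      have "S (B - {w}) = 0" if "w \<in> B" for w
        unfolding S_def by (rule less.hyps) (use less.prems that False in auto)
      then show ?thesis using uv by simp
    qed
    finally show ?case using uv by (simp add: S_def)
  qed
  show ?thesis using assms
  proof (induction I arbitrary: B rule: finite_induct)
    case empty
    then show ?case using base by simp
  next
    case (insert k I)
    define f where "f b = (\<Prod>i\<in>I. 1 - c i * b)" for b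
    \<comment> \<open>Any node \<open>a\<close> serves. Since
      \<open>1 - c k * b = (1 - c k * a) - c k * (b - a)\<close>, one sum over \<open>B\<close> and
      one over \<open>B - {a}\<close> remain; as \<open>I\<close> has one element fewer than
      \<open>insert k I\<close>, both have enough nodes.\<close>
    obtain a where a: "a \<in> B" using insert.prems by fastforce
    have "(\<Sum>b\<in>B. (\<Prod>i\<in>insert k I. 1 - c i * b) / (\<Prod>d\<in>B - {b}. b - d)) =
        (1 - c k * a) * (\<Sum>b\<in>B. f b / (\<Prod>d\<in>B - {b}. b - d))
        - c k * (\<Sum>b\<in>B. (b - a) * f b / (\<Prod>d\<in>B - {b}. b - d))"
      unfolding sum_distrib_left sum_subtractf[symmetric]
    proof (intro sum.cong refl)
      fix b
      have "(\<Prod>i\<in>insert k I. 1 - c i * b) = (1 - c k * a) * f b - c k * ((b - a) * f b)"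
        using insert.hyps by (simp add: f_def algebra_simps)
      then show "(\<Prod>i\<in>insert k I. 1 - c i * b) / (\<Prod>d\<in>B - {b}. b - d) =
          (1 - c k * a) * (f b / (\<Prod>d\<in>B - {b}. b - d)) - c k * ((b - a) * f b / (\<Prod>d\<in>B - {b}. b - d))"
        by (simp add: diff_divide_distrib)
    qed
    moreover have "(\<Sum>b\<in>B. f b / (\<Prod>d\<in>B - {b}. b - d)) = 0"
      unfolding f_def using insert by simp
    moreover have "(\<Sum>b\<in>B - {a}. f b / (\<Prod>d\<in>B - {a} - {b}. b - d)) = 0"
      unfolding f_def using insert a by (intro insert.IH) simp_all
    ultimately show ?case using step[of B a f] a insert.prems by simp
  qed
qed

text \<open>The hypotheses make \<open>0\<close>, \<open>1\<close>, \<open>- 1\<close> and the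
  elements of \<open>A\<close> distinct nodes. The terms at the three extra nodes are explicit and
  produce the right side; the term at \<open>a\<close> is the summand for \<open>a\<close> times a
  factor common to all \<open>a\<close>.\<close>

lemma sum_prod_complement_eq:
  fixes A :: "'a :: field set"
  assumes fin: "finite A" and "0 \<notin> A" "1 \<notin> A" "- 1 \<notin> A" and two: "(2 :: 'a) \<noteq> 0"
  shows "(\<Sum>a\<in>A. \<Prod>c\<in>A - {a}. c * (1 - c * a) / (c - a)) = (if even (card A) then 1 - \<Prod>A else 1)"
proof -
  define n where "n = card A"
  define B where "B = insert 0 (insert 1 (insert (- 1) A))"
  define T where "T b = (\<Prod>c\<in>A. 1 - c * b) / (\<Prod>d\<in>B - {b}. b - d)" for b
  define U where "U a = (\<Prod>c\<in>A - {a}. c * (1 - c * a) / (c - a))" for a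
  have m1: "(1 :: 'a) \<noteq> - 1"
    using two by (metis add.right_inverse one_add_one)
  have X: "\<Prod>A \<noteq> 0" using assms by simp
  have "card B = n + 3" using assms m1 by (simp add: B_def n_def)
  then have "(\<Sum>b\<in>B. T b) = 0"
    unfolding T_def using fin by (intro divided_difference_prod_eq_0) (simp_all add: B_def n_def)
  then have sum0: "T 0 + (T 1 + (T (- 1) + (\<Sum>a\<in>A. T a))) = 0"
    using assms m1 by (simp add: B_def)
  have "B - {0} = insert 1 (insert (- 1) A)" using assms m1 by (auto simp: B_def)
  then have T0: "T 0 = - ((- 1) ^ n / \<Prod>A)"
    using assms m1 by (cases "even n") (simp_all add: T_def prod_uminus n_def)
  have "B - {1} = insert 0 (insert (- 1) A)" using assms m1 by (auto simp: B_def)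
  then have T1: "T 1 = 1 / 2"
    using assms m1 by (simp add: T_def)
  have "B - {- 1} = insert 0 (insert 1 A)" using assms m1 by (auto simp: B_def)
  moreover have "(\<Prod>c\<in>A. - 1 - c) = (- 1) ^ n * (\<Prod>c\<in>A. 1 - c * (- 1))"
    unfolding n_def prod_constant[symmetric] prod.distrib[symmetric] by (intro prod.cong) auto
  moreover have "(\<Prod>c\<in>A. 1 - c * (- 1)) \<noteq> 0"
    using assms by (auto simp: add_eq_0_iff)
  ultimately have Tm1: "T (- 1) = (- 1) ^ n / 2"
    using assms m1 by (cases "even n") (simp_all add: T_def)
  have Ta: "T a = (- 1) ^ n / \<Prod>A * U a" if a: "a \<in> A" for a
  proof -
    have nz: "a \<noteq> 0" "a \<noteq> 1" "a \<noteq> - 1" "1 - a * a \<noteq> 0"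
      using a assms by (auto simp: square_eq_1_iff)
    have "B - {a} = insert 0 (insert 1 (insert (- 1) (A - {a})))"
      using a assms by (auto simp: B_def)
    then have "(\<Prod>d\<in>B - {a}. a - d) = a * ((a - 1) * ((a + 1) * (\<Prod>c\<in>A - {a}. a - c)))"
      using assms m1 by simp
    also have "\<dots> = - (a * (1 - a * a) * (\<Prod>c\<in>A - {a}. a - c))"
      by (simp add: algebra_simps)
    finally have den: "(\<Prod>d\<in>B - {a}. a - d) = - (a * (1 - a * a) * (\<Prod>c\<in>A - {a}. a - c))" .
    \<comment> \<open>The numerator's factor for \<open>c = a\<close> is \<open>1 - a * a\<close>,
      which cancels what the nodes \<open>1\<close> and \<open>- 1\<close> put into the
      denominator.\<close>
    have num: "(\<Prod>c\<in>A. 1 - c * a) = (1 - a * a) * (\<Prod>c\<in>A - {a}. 1 - c * a)"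
      using prod.remove[OF fin a] by simp
    have XA: "\<Prod>A = a * \<Prod>(A - {a})" using prod.remove[OF fin a, of "\<lambda>c. c"] by simp
    have n: "n = Suc (card (A - {a}))" using card.remove[OF fin a] by (simp only: n_def)
    have "(\<Prod>c\<in>A - {a}. a - c) = (- 1) ^ card (A - {a}) * (\<Prod>c\<in>A - {a}. c - a)"
      unfolding prod_constant[symmetric] prod.distrib[symmetric] by (intro prod.cong) auto
    then have sgn: "(\<Prod>c\<in>A - {a}. a - c) = - ((- 1) ^ n * (\<Prod>c\<in>A - {a}. c - a))"
      by (simp add: n)
    have dnz: "(\<Prod>c\<in>A - {a}. c - a) \<noteq> 0" using fin by simp
    have XA0: "\<Prod>(A - {a}) \<noteq> 0" using X XA by auto
    have "T a = (- 1) ^ n / a * ((\<Prod>c\<in>A - {a}. 1 - c * a) / (\<Prod>c\<in>A - {a}. c - a))"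
      unfolding T_def num den sgn using nz dnz by (cases "even n") simp_all
    also have "\<dots> = (- 1) ^ n / \<Prod>A * U a"
      unfolding U_def XA prod_dividef prod.distrib using nz dnz XA0 by (simp add: divide_simps)
    finally show ?thesis .
  qed
  have "(- 1) ^ n / \<Prod>A * (\<Sum>a\<in>A. U a) = (\<Sum>a\<in>A. T a)"
    unfolding sum_distrib_left using Ta by simp
  also have "\<dots> = (- 1) ^ n / \<Prod>A - 1 / 2 - (- 1) ^ n / 2"
    using sum0 unfolding T0 T1 Tm1 by (simp add: algebra_simps eq_neg_iff_add_eq_0)
  finally have *: "(- 1) ^ n / \<Prod>A * (\<Sum>a\<in>A. U a) = (- 1) ^ n / \<Prod>A - 1 / 2 - (- 1) ^ n / 2" .
  have half: "1 / 2 + 1 / 2 = (1 :: 'a)"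
    using two by (metis add_divide_distrib divide_self one_add_one)
  have "(\<Sum>a\<in>A. U a) = (if even n then 1 - \<Prod>A else 1)"
  \<comment> \<open>The nodes \<open>1\<close> and \<open>- 1\<close> together contribute
    \<open>(1 + (- 1) ^ n) / 2\<close>, which is 1 or 0: hence \<open>\<Prod>A\<close> survives for
    even \<open>n\<close> only.\<close>
  proof (cases "even n")
    case True
    then have "(\<Sum>a\<in>A. U a) / \<Prod>A = 1 / \<Prod>A - 1"
      using * half by (simp add: diff_diff_eq)
    then show ?thesis using True X by (simp add: field_simps)
  next
    case False
    then show ?thesis using * X by (simp add: field_simps)
  qed
  then show ?thesis by (simp add: U_def n_def)
qed

section \<open>Antisymmetric products over pairs\<close>

lemma finite_pairs_less: "finite (pairs_less n)"
  by (rule finite_subset[of _ "{1..n} \<times> {1..n}"]) (auto simp: pairs_less_def)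

text \<open>As for the Vandermonde product: the transposition permutes the unordered pairs, and each
  inversion costs a sign. The number of inversions is odd unless \<open>b = n\<close>.\<close>

lemma prod_pairs_less_transpose:
  fixes h :: "nat \<Rightarrow> nat \<Rightarrow> 'a :: comm_ring_1"
  assumes anti: "\<And>i j. h j i = - h i j" and b: "b \<in> {1..n}"
  shows "(\<Prod>(i, j)\<in>pairs_less n. h (transpose n b i) (transpose n b j)) =
    of_int (sign (transpose n b)) * (\<Prod>(i, j)\<in>pairs_less n. h i j)"
proof (cases "b = n")
  case True
  then show ?thesis by simp
next
  case False
  define \<tau> where "\<tau> = transpose n b"
  have inv: "\<tau> (\<tau> i) = i" for i by (simp add: \<tau>_def)
  have neq: "\<tau> i \<noteq> \<tau> j" if "i < j" for i j
    using that inv[of i] inv[of j] by (cases "\<tau> i = \<tau> j") simp_all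
  have ran: "\<tau> i \<in> {1..n} \<longleftrightarrow> i \<in> {1..n}" for i
    using b by (auto simp: \<tau>_def transpose_def)
  \<comment> \<open>The involution that the transposition induces on pairs, reordered so that the
    smaller entry comes first.\<close>
  define s where "s = (\<lambda>(i, j). if \<tau> i < \<tau> j then (\<tau> i, \<tau> j) else (\<tau> j, \<tau> i))"
  have s: "s p \<in> pairs_less n" "s (s p) = p" if "p \<in> pairs_less n" for p
  proof -
    obtain i j where p: "p = (i, j)" "i < j" "i \<in> {1..n}" "j \<in> {1..n}"
      using \<open>p \<in> pairs_less n\<close> by (auto simp: pairs_less_def)
    moreover have "\<tau> i \<noteq> \<tau> j" using p neq by simp
    moreover have "\<tau> i \<in> {1..n}" "\<tau> j \<in> {1..n}" using p ran by blast+
    ultimately show "s p \<in> pairs_less n" "s (s p) = p"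
      using inv by (auto simp: s_def pairs_less_def)
  qed
  have "(\<Prod>(i, j)\<in>pairs_less n. h (\<tau> i) (\<tau> j)) =
      (\<Prod>p\<in>pairs_less n. (case p of (i, j) \<Rightarrow> if \<tau> i < \<tau> j then 1 else - 1) * (case s p of (i, j) \<Rightarrow> h i j))"
  proof (intro prod.cong refl)
    fix p :: "nat \<times> nat"
    obtain i j where p: "p = (i, j)" by (cases p)
    show "(case p of (i, j) \<Rightarrow> h (\<tau> i) (\<tau> j)) =
        (case p of (i, j) \<Rightarrow> if \<tau> i < \<tau> j then 1 else - 1) * (case s p of (i, j) \<Rightarrow> h i j)"
      unfolding p s_def using anti[of "\<tau> i" "\<tau> j"] by simp
  qed
  also have "\<dots> = (\<Prod>p\<in>pairs_less n. case p of (i, j) \<Rightarrow> if \<tau> i < \<tau> j then 1 else - 1)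
      * (\<Prod>p\<in>pairs_less n. case s p of (i, j) \<Rightarrow> h i j)"
    by (rule prod.distrib)
  also have "(\<Prod>p\<in>pairs_less n. case s p of (i, j) \<Rightarrow> h i j) = (\<Prod>(i, j)\<in>pairs_less n. h i j)"
    by (rule prod.reindex_bij_witness[of _ s s]) (use s in auto)
  also have "(\<Prod>p\<in>pairs_less n. case p of (i, j) \<Rightarrow> if \<tau> i < \<tau> j then 1 else (- 1 :: 'a)) =
      (- 1) ^ card {(i, j) \<in> pairs_less n. \<tau> j < \<tau> i}"
  proof -
    have "(\<Prod>p\<in>pairs_less n. case p of (i, j) \<Rightarrow> if \<tau> i < \<tau> j then 1 else (- 1 :: 'a)) =
        (\<Prod>p\<in>pairs_less n. if p \<in> {(i, j). \<tau> j < \<tau> i} then - 1 else 1)"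
    proof (intro prod.cong refl)
      fix p assume "p \<in> pairs_less n"
      then obtain i j where p: "p = (i, j)" "i < j" by (auto simp: pairs_less_def)
      then have "\<tau> i \<noteq> \<tau> j" using neq by simp
      then show "(case p of (i, j) \<Rightarrow> if \<tau> i < \<tau> j then 1 else - 1) =
          (if p \<in> {(i, j). \<tau> j < \<tau> i} then - 1 else (1 :: 'a))"
        using p by auto
    qed
    also have "\<dots> = (- 1) ^ card (pairs_less n \<inter> {(i, j). \<tau> j < \<tau> i})"
      using finite_pairs_less by (simp add: prod.If_cases)
    also have "pairs_less n \<inter> {(i, j). \<tau> j < \<tau> i} = {(i, j) \<in> pairs_less n. \<tau> j < \<tau> i}" by auto
    finally show ?thesis .
  qed
  \<comment> \<open>For \<open>b < n\<close> the inverted pairs are those starting at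
    \<open>b\<close>, because \<open>b\<close> goes to the top, and those ending at
    \<open>n\<close>, because \<open>n\<close> goes down to \<open>b\<close>. The pair
    \<open>(b, n)\<close> is counted in the first set only.\<close>
  also have "{(i, j) \<in> pairs_less n. \<tau> j < \<tau> i} = {b} \<times> {b<..n} \<union> {b<..<n} \<times> {n}"
    using b False by (auto simp: \<tau>_def transpose_def pairs_less_def split: if_splits)
  also have "card ({b} \<times> {b<..n} \<union> {b<..<n} \<times> {n}) = (n - b) + (n - b - 1)"
    by (subst card_Un_disjoint) auto
  also have "(- 1 :: 'a) ^ ((n - b) + (n - b - 1)) = - 1"
  proof -
    have "(n - b) + (n - b - 1) = Suc (2 * (n - b - 1))" using b False by auto
    then show ?thesis by simp
  qed
  also have "(- 1 :: 'a) = of_int (sign (transpose n b))"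
    using False by (simp add: sign_swap_id)
  finally show ?thesis by (simp add: \<tau>_def)
qed

lemma prod_pairs_less_Suc:
  "(\<Prod>p\<in>pairs_less (Suc n). f p) = (\<Prod>p\<in>pairs_less n. f p) * (\<Prod>i = 1..n. f (i, Suc n))"
proof -
  have "pairs_less (Suc n) = pairs_less n \<union> (\<lambda>i. (i, Suc n)) ` {1..n}"
    by (auto simp: pairs_less_def le_Suc_eq)
  moreover have "pairs_less n \<inter> (\<lambda>i. (i, Suc n)) ` {1..n} = {}"
    by (auto simp: pairs_less_def)
  ultimately have "(\<Prod>p\<in>pairs_less (Suc n). f p) = (\<Prod>p\<in>pairs_less n. f p) * (\<Prod>p\<in>(\<lambda>i. (i, Suc n)) ` {1..n}. f p)"
    by (simp add: prod.union_disjoint finite_pairs_less)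
  also have "(\<Prod>p\<in>(\<lambda>i. (i, Suc n)) ` {1..n}. f p) = (\<Prod>i = 1..n. f (i, Suc n))"
    by (subst prod.reindex) (auto simp: inj_on_def)
  finally show ?thesis .
qed

section \<open>The identity for elements of a field\<close>

text \<open>The hypotheses pass to reordered subfamilies, since the induction drops an arbitrary
  \<open>x b\<close>; this is why all nonempty subsets occur and not just initial segments.
  Two-element subsets give \<open>x i * x j \<noteq> 1\<close>; the condition on squares excludes
  the values \<open>1\<close> and \<open>- 1\<close>, and \<open>two\<close> keeps these
  apart.\<close>

lemma prod_pairs_less_eq_sum_permutes:
  fixes x :: "nat \<Rightarrow> 'a :: field"
  assumes two: "(2 :: 'a) \<noteq> 0" and "inj_on x {1..n}"
    and "\<And>i. i \<in> {1..n} \<Longrightarrow> x i \<noteq> 0" and "\<And>i. i \<in> {1..n} \<Longrightarrow> x i * x i \<noteq> 1"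
    and "\<And>S. S \<subseteq> {1..n} \<Longrightarrow> S \<noteq> {} \<Longrightarrow> prod x S \<noteq> 1"
  shows "(\<Prod>(i, j)\<in>pairs_less n. (x i - x j) / (1 - x i * x j)) =
    (\<Sum>w | w permutes {1..n}. of_int (sign w) *
      ((\<Prod>i = 1..n. x (w i) ^ (n - i)) / (\<Prod>k = 1..n div 2. 1 - (\<Prod>i = 1..2 * k. x (w i)))))"
  using assms(2-)
proof (induction n arbitrary: x)
  case 0
  have "pairs_less 0 = {}" by (auto simp: pairs_less_def)
  then show ?case by simp
next
  case (Suc n)
  define A where "A = {1..Suc n}"
  define h where "h i j = (x i - x j) / (1 - x i * x j)" for i j
  define P where "P = prod x A"
  \<comment> \<open>Both the denominator factor gained in passing from \<open>n\<close> to
    \<open>Suc n\<close> and the value of the residue sum, so it cancels at the end.\<close>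
  define Z where "Z = (if even (Suc n) then 1 - P else 1)"
  define D where "D = (\<Prod>(i, j)\<in>pairs_less (Suc n). h i j)"
  define F where "F m x w = of_int (sign w) * ((\<Prod>i = 1..m. x (w i) ^ (m - i)) /
    (\<Prod>k = 1..m div 2. 1 - (\<Prod>i = 1..2 * k. x (w i))))" for m and x :: "nat \<Rightarrow> 'a" and w
  have A: "A = insert (Suc n) {1..n}" by (auto simp: A_def)
  have inj: "inj_on x A" and x0: "\<And>i. i \<in> A \<Longrightarrow> x i \<noteq> 0" and xx: "\<And>i. i \<in> A \<Longrightarrow> x i * x i \<noteq> 1"
    and xS: "\<And>S. S \<subseteq> A \<Longrightarrow> S \<noteq> {} \<Longrightarrow> prod x S \<noteq> 1"
    using Suc.prems by (simp_all add: A_def)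
  have xij: "x i * x j \<noteq> 1" "x i \<noteq> x j" if "i \<in> A" "j \<in> A" "i \<noteq> j" for i j
    using xS[of "{i, j}"] that inj by (auto simp: inj_on_def)
  have Z0: "Z \<noteq> 0" using xS[of A] by (auto simp: Z_def P_def A_def)
  \<comment> \<open>The contribution of the permutations \<open>w\<close> with
    \<open>w (Suc n) = b\<close>: here \<open>q\<close> fixes \<open>Suc n\<close>, which the
    transposition then sends to \<open>b\<close>.\<close>
  have inner: "(\<Sum>q | q permutes {1..n}. F (Suc n) x (transpose (Suc n) b \<circ> q)) =
      D / Z * (\<Prod>i\<in>A - {b}. x i * (1 - x i * x b) / (x i - x b))" if b: "b \<in> A" for b
  proof -
    define \<tau> where "\<tau> = transpose (Suc n) b"
    \<comment> \<open>On \<open>{1..n}\<close> this lists the \<open>x i\<close> with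
      \<open>i \<noteq> b\<close>; the induction hypothesis is applied to it.\<close>
    define y where "y = x \<circ> \<tau>"
    have \<tau>: "\<tau> permutes A" unfolding \<tau>_def
      by (rule permutes_swap_id) (use b in \<open>auto simp: A_def\<close>)
    have inj\<tau>: "inj_on \<tau> S" for S using permutes_inj[OF \<tau>] by (rule inj_on_subset) simp
    have img: "\<tau> ` {1..n} = A - {b}"
    proof -
      have "\<tau> ` (A - {Suc n}) = \<tau> ` A - \<tau> ` {Suc n}"
        using permutes_inj[OF \<tau>] by (rule image_set_diff)
      also have "\<dots> = A - {b}" using permutes_image[OF \<tau>] by (simp add: \<tau>_def)
      finally show ?thesis by (simp add: A atLeastAtMostSuc_conv)
    qed
    have y_prod: "(\<Prod>i = 1..n. g (y i)) = (\<Prod>i\<in>A - {b}. g (x i))" for g :: "'a \<Rightarrow> 'a"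
      unfolding img[symmetric] by (subst prod.reindex[OF inj\<tau>]) (simp add: y_def)
    have F: "F (Suc n) x (\<tau> \<circ> q) = of_int (sign \<tau>) * (prod x (A - {b}) / Z) * F n y q"
      if q: "q permutes {1..n}" for q
    proof -
      have "sign (\<tau> \<circ> q) = sign \<tau> * sign q"
        using \<tau> q by (intro sign_compose permutes_imp_permutation[of A] permutes_imp_permutation[of "{1..n}"])
          (auto simp: A_def)
      \<comment> \<open>Every exponent at \<open>i \<le> n\<close> grows by one and the exponent at
        \<open>Suc n\<close> is 0, so the gain is the product of all \<open>x i\<close> with
        \<open>i \<noteq> b\<close>.\<close>
      moreover have "(\<Prod>i = 1..Suc n. x ((\<tau> \<circ> q) i) ^ (Suc n - i)) =
          prod x (A - {b}) * (\<Prod>i = 1..n. y (q i) ^ (n - i))"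
      proof -
        have "(\<Prod>i = 1..Suc n. x ((\<tau> \<circ> q) i) ^ (Suc n - i)) = (\<Prod>i = 1..n. y (q i) * y (q i) ^ (n - i))"
          by (simp add: y_def Suc_diff_le)
        also have "\<dots> = (\<Prod>i = 1..n. y (q i)) * (\<Prod>i = 1..n. y (q i) ^ (n - i))"
          by (rule prod.distrib)
        also have "(\<Prod>i = 1..n. y (q i)) = (\<Prod>i = 1..n. y i)"
          using prod.permute[OF q, of y] by (simp add: o_def)
        also have "\<dots> = prod x (A - {b})" using y_prod[of "\<lambda>z. z"] by simp
        finally show ?thesis .
      qed
      \<comment> \<open>A new factor arises only for even \<open>Suc n\<close>. Its product runs
        over all of \<open>A\<close>, so it does not depend on the permutation.\<close>
      moreover have "(\<Prod>k = 1..Suc n div 2. 1 - (\<Prod>i = 1..2 * k. x ((\<tau> \<circ> q) i))) =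
          Z * (\<Prod>k = 1..n div 2. 1 - (\<Prod>i = 1..2 * k. y (q i)))"
      proof (cases "even (Suc n)")
        case True
        then have d: "Suc n div 2 = Suc (n div 2)" "2 * Suc (n div 2) = Suc n" by presburger+
        have "(\<Prod>i = 1..Suc n. x ((\<tau> \<circ> q) i)) = P"
        proof -
          have "q permutes A" using q by (rule permutes_subset) (auto simp: A_def)
          then have "\<tau> \<circ> q permutes A" using \<tau> by (rule permutes_compose)
          from prod.permute[OF this, of x] show ?thesis by (simp add: P_def A_def o_def)
        qed
        then show ?thesis using True unfolding d(1)
          by (subst prod.nat_ivl_Suc') (simp_all only: d, simp_all add: Z_def y_def)
      next
        case False
        then have "Suc n div 2 = n div 2" by presburger
        then show ?thesis using False by (simp add: Z_def y_def)
      qed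
      ultimately show ?thesis by (simp add: F_def)
    qed
    have IH: "(\<Sum>q | q permutes {1..n}. F n y q) = (\<Prod>(i, j)\<in>pairs_less n. h (\<tau> i) (\<tau> j))"
    proof -
      have sub: "\<tau> ` S \<subseteq> A" if "S \<subseteq> {1..n}" for S using that img by blast
      have "(\<Prod>(i, j)\<in>pairs_less n. (y i - y j) / (1 - y i * y j)) = (\<Sum>q | q permutes {1..n}. F n y q)"
        unfolding F_def
      proof (rule Suc.IH)
        show "inj_on y {1..n}" unfolding y_def
          using inj\<tau> inj_on_subset[OF inj sub[OF order_refl]] by (rule comp_inj_on)
        show "y i \<noteq> 0" "y i * y i \<noteq> 1" if "i \<in> {1..n}" for i
        proof -
          have "\<tau> i \<in> A" using that img by blast
          then show "y i \<noteq> 0" "y i * y i \<noteq> 1" using x0 xx by (simp_all add: y_def)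
        qed
        show "prod y S \<noteq> 1" if "S \<subseteq> {1..n}" "S \<noteq> {}" for S
          using xS[OF sub[OF that(1)]] that(2) prod.reindex[OF inj\<tau>, of x S] by (simp add: y_def)
      qed
      then show ?thesis by (simp add: h_def y_def)
    qed
    \<comment> \<open>The inverse of the factors of the transposed product that belong to pairs
      ending in \<open>Suc n\<close>; multiplying by it leaves the pairs below
      \<open>Suc n\<close>.\<close>
    define G where "G = (\<Prod>i\<in>A - {b}. (1 - x i * x b) / (x i - x b))"
    have "of_int (sign \<tau>) * D = (\<Prod>(i, j)\<in>pairs_less (Suc n). h (\<tau> i) (\<tau> j))"
      unfolding D_def \<tau>_def
      by (rule prod_pairs_less_transpose[symmetric])
        (use b in \<open>auto simp: A_def h_def mult.commute minus_divide_left\<close>)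
    also have "\<dots> = (\<Prod>(i, j)\<in>pairs_less n. h (\<tau> i) (\<tau> j)) * (\<Prod>i = 1..n. (y i - x b) / (1 - y i * x b))"
      by (simp add: prod_pairs_less_Suc h_def y_def \<tau>_def)
    also have "(\<Prod>i = 1..n. (y i - x b) / (1 - y i * x b)) = (\<Prod>i\<in>A - {b}. (x i - x b) / (1 - x i * x b))"
      by (rule y_prod)
    finally have "of_int (sign \<tau>) * D * G = (\<Prod>(i, j)\<in>pairs_less n. h (\<tau> i) (\<tau> j)) *
        ((\<Prod>i\<in>A - {b}. (x i - x b) / (1 - x i * x b)) * G)" by simp
    also have "(\<Prod>i\<in>A - {b}. (x i - x b) / (1 - x i * x b)) * G = 1"
      unfolding G_def prod.distrib[symmetric] using b xij by (intro prod.neutral) auto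
    finally have DG: "(\<Prod>(i, j)\<in>pairs_less n. h (\<tau> i) (\<tau> j)) = of_int (sign \<tau>) * D * G" by simp
    have "(\<Sum>q | q permutes {1..n}. F (Suc n) x (\<tau> \<circ> q)) =
        (\<Sum>q | q permutes {1..n}. of_int (sign \<tau>) * (prod x (A - {b}) / Z) * F n y q)"
      by (intro sum.cong refl) (simp only: mem_Collect_eq F)
    also have "\<dots> = of_int (sign \<tau>) * (prod x (A - {b}) / Z) * (of_int (sign \<tau>) * D * G)"
      by (simp only: sum_distrib_left[symmetric] IH DG)
    also have "\<dots> = of_int (sign \<tau> * sign \<tau>) * (D / Z) * (prod x (A - {b}) * G)"
      by (simp add: algebra_simps del: sign_idempotent)
    also have "\<dots> = D / Z * (\<Prod>i\<in>A - {b}. x i * (1 - x i * x b) / (x i - x b))"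
      by (simp add: G_def prod.distrib[symmetric])
    finally show ?thesis by (simp add: \<tau>_def)
  qed
  \<comment> \<open>The residue sum is indexed by field elements, so injectivity of \<open>x\<close>
    is used to replace the index \<open>b\<close> by the value \<open>x b\<close>.\<close>
  have core: "(\<Sum>b\<in>A. \<Prod>i\<in>A - {b}. x i * (1 - x i * x b) / (x i - x b)) = Z"
  proof -
    have "(\<Sum>b\<in>A. \<Prod>i\<in>A - {b}. x i * (1 - x i * x b) / (x i - x b)) =
        (\<Sum>b\<in>A. \<Prod>c\<in>x ` A - {x b}. c * (1 - c * x b) / (c - x b))"
    proof (intro sum.cong refl)
      fix b assume "b \<in> A"
      then have "x ` A - {x b} = x ` (A - {b})" using inj by (auto simp: inj_on_def)
      then show "(\<Prod>i\<in>A - {b}. x i * (1 - x i * x b) / (x i - x b)) =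
          (\<Prod>c\<in>x ` A - {x b}. c * (1 - c * x b) / (c - x b))"
        using inj by (simp add: prod.reindex inj_on_diff)
    qed
    also have "\<dots> = (\<Sum>a\<in>x ` A. \<Prod>c\<in>x ` A - {a}. c * (1 - c * a) / (c - a))"
      using inj by (simp add: sum.reindex)
    also have "\<dots> = (if even (card (x ` A)) then 1 - \<Prod>(x ` A) else 1)"
    proof (rule sum_prod_complement_eq[OF _ _ _ _ two])
      show "finite (x ` A)" by (simp add: A_def)
      show "0 \<notin> x ` A" using x0 by fastforce
      have "z * z \<noteq> 1" if "z \<in> x ` A" for z using that xx by blast
      from this[of 1] this[of "- 1"] show "1 \<notin> x ` A" "- 1 \<notin> x ` A" by auto
    qed
    also have "\<dots> = Z"
      using inj by (simp add: card_image prod.reindex Z_def P_def) (simp add: A_def)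
    finally show ?thesis .
  qed
  \<comment> \<open>Each permutation of \<open>A\<close> is
    \<open>transpose (Suc n) b \<circ> q\<close> for exactly one \<open>b\<close> in
    \<open>A\<close> and one \<open>q\<close> permuting \<open>{1..n}\<close>.\<close>
  have "(\<Sum>w | w permutes {1..Suc n}. F (Suc n) x w) =
      (\<Sum>b\<in>A. \<Sum>q | q permutes {1..n}. F (Suc n) x (transpose (Suc n) b \<circ> q))"
    unfolding A_def[symmetric] unfolding A
    by (rule sum_over_permutations_insert) auto
  also have "\<dots> = D / Z * Z"
    by (simp only: inner sum_distrib_left[symmetric] core cong: sum.cong)
  also have "\<dots> = D" using Z0 by simp
  finally show ?case by (simp add: D_def h_def F_def)
qed

section \<open>Specialisation to formal exponentials\<close>

lemma fexp_sum: "fexp (\<Sum>i\<in>A. f i) = (\<Prod>i\<in>A. fexp (f i))"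
  by (induction A rule: infinite_finite_induct) (simp_all add: fexp_0 fexp_add)

lemma fexp_neq_0: "fexp u \<noteq> 0"
  using fexp_add[of u "- u"] by (auto simp: fexp_0)

lemma fexp_diff: "fexp (u - v) = fexp u / fexp v"
  using fexp_add[of "u - v" v] by (simp add: fexp_neq_0 field_simps)

lemma fexp_scale_of_nat: "fexp (scale (of_nat k) u) = fexp u ^ k"
proof (induction k)
  case 0
  have "scale (of_nat 0) u = 0" by (rule weight_eqI) simp
  then show ?case by (simp add: fexp_0)
next
  case (Suc k)
  have "scale (of_nat (Suc k)) u = u + scale (of_nat k) u"
    by (rule weight_eqI) (simp add: algebra_simps)
  then show ?case by (simp add: fexp_add Suc)
qed

text \<open>The coefficient of \<open>1 + 1\<close> at the weight 0 is the complex number 2.\<close>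

lemma two_neq_0_expfield: "(2 :: expfield) \<noteq> 0"
proof -
  have "(1 + 1 :: weight \<Rightarrow>\<^sub>0 complex) \<noteq> 0"
  proof
    assume "(1 + 1 :: weight \<Rightarrow>\<^sub>0 complex) = 0"
    then have "Poly_Mapping.lookup (1 + 1 :: weight \<Rightarrow>\<^sub>0 complex) 0 = 0" by (simp only: lookup_zero)
    then have "(1 + 1 :: complex) = 0" by (simp only: lookup_add lookup_one when_simps refl)
    then show False by simp
  qed
  then have "Fract (1 + 1 :: weight \<Rightarrow>\<^sub>0 complex) 1 \<noteq> Fract 0 1"
    by (simp only: eq_fract(1)[OF one_neq_zero one_neq_zero] mult_1_right mult_zero_left not_False_eq_True)
  moreover have "(2 :: expfield) = Fract (1 + 1) 1"
    by (metis One_fract_def add_fract mult_1 one_add_one zero_neq_one mult.right_neutral)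
  ultimately show ?thesis by (simp only: Zero_fract_def not_False_eq_True)
qed

lemma fexp_rho: "fexp (rho n) = (\<Prod>i = 1..n. fexp (eps i) ^ (n - i))"
  by (simp only: rho_def fexp_sum fexp_scale_of_nat)

text \<open>The index pairs \<open>2 * j - 1\<close>, \<open>2 * j\<close> of the
  \<open>beta j\<close> fill \<open>{1..2 * k}\<close> without overlap.\<close>

lemma fexp_beta_sum: "fexp (- (\<Sum>j = 1..k. beta j)) = (\<Prod>i = 1..2 * k. fexp (eps i))"
proof (induction k)
  case (Suc k)
  have "- (\<Sum>j = 1..Suc k. beta j) = - (\<Sum>j = 1..k. beta j) + (eps (Suc (2 * k)) + eps (Suc (Suc (2 * k))))"
    by (simp add: beta_def)
  then have "fexp (- (\<Sum>j = 1..Suc k. beta j)) =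
      (\<Prod>i = 1..2 * k. fexp (eps i)) * (fexp (eps (Suc (2 * k))) * fexp (eps (Suc (Suc (2 * k)))))"
    by (simp only: fexp_add Suc)
  then show ?case by (simp add: mult.assoc)
qed (simp add: fexp_0)

lemma W_act_prod: "W_act w (\<Prod>i\<in>A. f i) = (\<Prod>i\<in>A. W_act w (f i))"
  by (induction A rule: infinite_finite_induct) (simp_all add: W_act_1 W_act_mult)

lemma W_act_power: "W_act w (x ^ k) = W_act w x ^ k"
  by (induction k) (simp_all add: W_act_1 W_act_mult)

lemma W_act_diff: "W_act w (x - y) = W_act w x - W_act w y"
  using W_act_add[of w "x - y" y] by simp

text \<open>The coefficient \<open>n - i\<close> in \<open>rho n\<close> counts the pairs
  \<open>(i, j)\<close> with \<open>j > i\<close>. Giving each of them one factor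
  \<open>fexp (eps i)\<close> turns the even factor of the numerator into a difference of two
  exponentials.\<close>

lemma fexp_rho_denom_R:
  "fexp (rho n) * denom_R n =
    (\<Prod>(i, j)\<in>pairs_less n. (fexp (eps i) - fexp (eps j)) / (1 - fexp (eps i) * fexp (eps j)))"
proof -
  have pairs: "pairs_less n = Sigma {1..n} (\<lambda>i. {i<..n})"
    by (auto simp: pairs_less_def)
  have "fexp (rho n) = (\<Prod>i = 1..n. \<Prod>j\<in>{i<..n}. fexp (eps i))"
    by (simp add: fexp_rho)
  also have "\<dots> = (\<Prod>(i, j)\<in>pairs_less n. fexp (eps i))"
    unfolding pairs by (subst prod.Sigma) auto
  finally have "fexp (rho n) * denom_R n = (\<Prod>(i, j)\<in>pairs_less n. fexp (eps i) *
      ((1 - fexp (- (eps i - eps j))) / (1 - fexp (eps i + eps j))))"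
    unfolding denom_R_explicit by (simp add: case_prod_unfold prod.distrib prod_dividef)
  also have "\<dots> = (\<Prod>(i, j)\<in>pairs_less n. (fexp (eps i) - fexp (eps j)) / (1 - fexp (eps i) * fexp (eps j)))"
    by (intro prod.cong refl)
      (auto simp: fexp_diff fexp_add fexp_neq_0 right_diff_distrib)
  finally show ?thesis .
qed

theorem theorem3p2:
  fixes n :: nat
  assumes "n \<ge> 1"
  shows "fexp (rho n) * denom_R n =
    (\<Sum>w | w permutes {1..n}.
       of_int (sign w) *
       W_act w (fexp (rho n) / (\<Prod>k = 1..n div 2. 1 - fexp (- (\<Sum>j = 1..k. beta j)))))"
proof -
  let ?x = "\<lambda>i. fexp (eps i)"
  \<comment> \<open>This supplies the subset hypothesis: a product of exponentials is 1 only if the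
    weights sum to 0.\<close>
  have sum_neq_0: "(\<Sum>i\<in>S. eps i) \<noteq> 0" if S: "finite S" "S \<noteq> {}" for S
  proof
    assume 0: "(\<Sum>i\<in>S. eps i) = 0"
    obtain k where "k \<in> S" using S(2) by blast
    then have "coord (\<Sum>i\<in>S. eps i) k = 1"
      using S(1) by (simp add: coord_sum coord_eps)
    with 0 show False by simp
  qed
  \<comment> \<open>\<open>W_act w\<close> respects the field operations, so it only replaces each
    index \<open>i\<close> by \<open>w i\<close>.\<close>
  have W: "W_act w (fexp (rho n) / (\<Prod>k = 1..n div 2. 1 - fexp (- (\<Sum>j = 1..k. beta j)))) =
      (\<Prod>i = 1..n. ?x (w i) ^ (n - i)) / (\<Prod>k = 1..n div 2. 1 - (\<Prod>i = 1..2 * k. ?x (w i)))"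
    if "w permutes {1..n}" for w
    using permutes_bij[OF that] unfolding fexp_rho fexp_beta_sum
    by (simp add: W_act_divide W_act_prod W_act_power W_act_diff W_act_1
        W_act_fexp wt_act_eps)
  have "fexp (rho n) * denom_R n =
      (\<Sum>w | w permutes {1..n}. of_int (sign w) *
        ((\<Prod>i = 1..n. ?x (w i) ^ (n - i)) / (\<Prod>k = 1..n div 2. 1 - (\<Prod>i = 1..2 * k. ?x (w i)))))"
    unfolding fexp_rho_denom_R
  proof (rule prod_pairs_less_eq_sum_permutes)
    show "(2 :: expfield) \<noteq> 0" by (rule two_neq_0_expfield)
    show "inj_on ?x {1..n}"
    proof (rule inj_onI)
      fix i j assume "?x i = ?x j"
      then have "coord (eps i) i = coord (eps j) i" by (simp only: fexp_inject)
      then show "i = j" by (simp add: coord_eps split: if_splits)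
    qed
    show "?x i \<noteq> 0" for i by (rule fexp_neq_0)
    show "?x i * ?x i \<noteq> 1" for i
    proof
      assume "?x i * ?x i = 1"
      then have "eps i + eps i = 0" by (simp only: fexp_inject flip: fexp_add fexp_0)
      then have "coord (eps i + eps i) i = 0" by simp
      then show False by (simp add: coord_eps)
    qed
    show "prod ?x S \<noteq> 1" if "S \<subseteq> {1..n}" "S \<noteq> {}" for S
      using sum_neq_0[of S] that finite_subset[OF that(1)]
      by (simp only: fexp_inject flip: fexp_sum fexp_0) simp
  qed
  then show ?thesis using W by simp
qed

end
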